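(* Let $M,N$ be positive integers, $\alpha>0$ and $t\ge0$. Let $\xi_t$ and $\tilde\xi_t$ be the two-shock half-line open TASEPs with boundary rate $\alpha$ described in the context, let $g(t)$ be the position of the unique second-class particle of $\xi_t$, let $\mathsf{N}_i(1,t)$ be the number of particles of color $i\in\{1,2,3\}$ in $\tilde\xi_t$ at sites $\ge1$, and let $\mathcal{N}(x,t)$ be the number of particles at sites $\ge x$ at time $t$ in the standard half-line open TASEP with boundary rate $\alpha$ started from the empty configuration. Then $$\mathbb{P}(g(t)<0)=\mathbb{P}\Big(\mathcal{N}(N+M+1,t)-\mathcal{N}(2N+2M+2,t)+\min\{N,\ \mathcal{N}(1,t)-\mathcal{N}(N+M+1,t)\}\ge N+M+1\Big).$$ Moreover, jointly, $$\big(\mathsf{N}_1(1,t),\mathsf{N}_2(1,t),\mathsf{N}_3(1,t)\big)\stackrel{d}{=}\big(X_1,X_2,X_3\big),$$ where $$X_1=\mathcal{N}(1,t),\qquad X_2=\min\{M,\ M+N-\mathcal{N}(1,t)+\mathcal{N}(M+N+1,t)\},$$ $$X_3=\min\Big\{N+1,\ M+N+1-\mathcal{N}(M+N+1,t)+\mathcal{N}(2M+2N+2,t)+\max\{0,\ N-\mathcal{N}(1,t)+\mathcal{N}(M+N+1,t)\}\Big\},$$ and $\stackrel{d}{=}$ denotes equality in distribution.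
   Context: Multi-color half-line open TASEP: a continuous-time Markov process on configurations $\eta:\mathbb{Z}_{>0}\to\{1,2,3,+\infty\}$, where $1,2,3$ denote first-, second- and third-class particles and $+\infty$ a hole. Dynamics: independently for each $x\ge1$, at rate $1$ the contents of sites $x$ and $x+1$ are exchanged if $\eta(x)<\eta(x+1)$ (nothing happens otherwise); at rate $\alpha$, if $\eta(1)>1$, the content of site $1$ is replaced by a first-class particle (nothing happens otherwise). In particular, a second- or third-class particle at site $1$ that is replaced in this way leaves the system permanently. Initial condition of $\xi_t$ (no third-class particles): holes on $[1,N]$; first-class particles on $[N+1,N+M]$; holes on $[N+M+1,N+2M]$; one second-class particle at $N+2M+1$; first-class particles on $[N+2M+2,2N+2M+1]$; holes at all sites $>2N+2M+1$. Initial condition of $\tilde\xi_t$ (same dynamics): second-class particles on $[N+1,N+M]$; third-class particles on $[N+2M+1,2N+2M+1]$; holes at all other sites $x\ge1$. $g(t)$ is the position of the unique second-class particle of $\xi_t$; $g(t)>0$ means that this particle is still in the system at time $t$, and $g(t)<0$ means that it has left (disappeared from) the system by time $t$. Standard half-line open TASEP with step initial condition: the same dynamics with only first-class particles and holes, started with all sites of $\mathbb{Z}_{>0}$ empty (holes); $\mathcal{N}(x,t)$ is the number of its particles at sites $\ge x$ at time $t$. *)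

theory Defs
  imports "HOL-Probability.Probability"
begin

text \<open>
  Colours are the values \<open>1, 2, 3, \<infinity>\<close> of \<^typ>\<open>enat\<close>, with \<open>\<infinity>\<close> a hole; the order of
  \<^typ>\<open>enat\<close> is the priority order. The sites are the positive naturals. The value of a
  configuration at \<open>0\<close> carries no meaning: it is \<open>\<infinity>\<close> in all initial conditions below, is never
  changed by the dynamics and never influences the other sites.
\<close>

type_synonym config = "nat \<Rightarrow> enat"

text \<open>
  Effect of a ring of clock \<open>i\<close>: clock \<open>0\<close> is the boundary reservoir, clock \<open>i \<ge> 1\<close> belongs to
  the bond between the sites \<open>i\<close> and \<open>i + 1\<close>.
\<close>

definition ring_update :: "nat \<Rightarrow> config \<Rightarrow> config" where
  "ring_update i \<eta> =
     (if i = 0 then (if \<eta> 1 > 1 then \<eta>(1 := 1) else \<eta>)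
      else (if \<eta> i < \<eta> (i + 1) then \<eta>(i := \<eta> (i + 1), i + 1 := \<eta> i) else \<eta>))"

definition clock_rate :: "real \<Rightarrow> nat \<Rightarrow> real" where
  "clock_rate \<alpha> i = (if i = 0 then \<alpha> else 1)"

text \<open>
  \<open>R i \<omega>\<close> is the set of ring times of clock \<open>i\<close>. The clocks are independent Poisson processes with
  rates \<open>r i\<close>: along every time grid, the numbers of rings of the various clocks in the various
  cells of the grid are jointly independent (over both clocks and cells) Poisson variables.
\<close>

definition poisson_clocks ::
  "'w measure \<Rightarrow> (nat \<Rightarrow> real) \<Rightarrow> (nat \<Rightarrow> 'w \<Rightarrow> real set) \<Rightarrow> bool" where
  "poisson_clocks \<mu> r R \<longleftrightarrow>
     prob_space \<mu> \<and>
     (\<forall>i. AE \<omega> in \<mu>. R i \<omega> \<subseteq> {0<..} \<and> (\<forall>b. finite (R i \<omega> \<inter> {0<..b}))) \<and>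
     (\<forall>s :: nat \<Rightarrow> real. 0 \<le> s 0 \<longrightarrow> strict_mono s \<longrightarrow>
        prob_space.indep_vars \<mu> (\<lambda>_. count_space UNIV)
          (\<lambda>(i, k) \<omega>. card (R i \<omega> \<inter> {s k<..s (Suc k)})) UNIV \<and>
        (\<forall>i k. distr \<mu> (count_space UNIV) (\<lambda>\<omega>. card (R i \<omega> \<inter> {s k<..s (Suc k)})) =
           measure_pmf (poisson_pmf (r i * (s (Suc k) - s k)))))"

text \<open>
  The (deterministic) trajectory \<open>\<eta>\<close> started from \<open>\<eta>0\<close> and driven by the ring times \<open>R\<close>. As the set
  of colours is discrete, a coordinate is right-continuous with left limits when it is locally
  constant on each side; \<open>\<zeta>\<close> is the configuration just before time \<open>t\<close>. Almost surely no two
  clocks ring simultaneously, so it does not matter that such ring times are treated badly.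
\<close>

definition driven_path :: "(nat \<Rightarrow> real set) \<Rightarrow> config \<Rightarrow> (real \<Rightarrow> config) \<Rightarrow> bool" where
  "driven_path R \<eta>0 \<eta> \<longleftrightarrow>
     \<eta> 0 = \<eta>0 \<and>
     (\<forall>t\<ge>0. \<forall>x. \<forall>\<^sub>F s in at_right t. \<eta> s x = \<eta> t x) \<and>
     (\<forall>t>0. \<exists>\<zeta>. (\<forall>x. \<forall>\<^sub>F s in at_left t. \<eta> s x = \<zeta> x) \<and>
        (\<forall>i. t \<in> R i \<longrightarrow> \<eta> t = ring_update i \<zeta>) \<and>
        ((\<forall>i. t \<notin> R i) \<longrightarrow> \<eta> t = \<zeta>))"

text \<open>
  \<open>X\<close> is a multi-colour half-line open TASEP with boundary rate \<open>\<alpha>\<close> started from \<open>\<eta>0\<close>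
  (Harris' graphical construction), on an arbitrary probability space. The times are the
  nonnegative reals; the values \<open>X t\<close> for \<open>t < 0\<close> are irrelevant.
\<close>

definition half_line_open_tasep ::
  "'w measure \<Rightarrow> real \<Rightarrow> config \<Rightarrow> (real \<Rightarrow> 'w \<Rightarrow> config) \<Rightarrow> bool" where
  "half_line_open_tasep \<mu> \<alpha> \<eta>0 X \<longleftrightarrow>
     prob_space \<mu> \<and>
     (\<forall>t\<ge>0. \<forall>x. (\<lambda>\<omega>. X t \<omega> x) \<in> measurable \<mu> (count_space UNIV)) \<and>
     (\<exists>R. poisson_clocks \<mu> (clock_rate \<alpha>) R \<and>
          (AE \<omega> in \<mu>. driven_path (\<lambda>i. R i \<omega>) \<eta>0 (\<lambda>t. X t \<omega>)))"

definition xi_init :: "nat \<Rightarrow> nat \<Rightarrow> config" where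
  "xi_init M N x =
     (if x \<in> {N + 1..N + M} then 1
      else if x = N + 2 * M + 1 then 2
      else if x \<in> {N + 2 * M + 2..2 * N + 2 * M + 1} then 1
      else \<infinity>)"

definition xi_tilde_init :: "nat \<Rightarrow> nat \<Rightarrow> config" where
  "xi_tilde_init M N x =
     (if x \<in> {N + 1..N + M} then 2
      else if x \<in> {N + 2 * M + 1..2 * N + 2 * M + 1} then 3
      else \<infinity>)"

definition empty_init :: config where
  "empty_init x = \<infinity>"

text \<open>
  The number of particles of colour \<open>c\<close> at sites \<open>\<ge> x\<close>, for \<open>x \<ge> 1\<close>. It is integer-valued because
  it is used with genuine subtraction.
\<close>

definition num_ge :: "enat \<Rightarrow> nat \<Rightarrow> config \<Rightarrow> int" where
  "num_ge c x \<eta> = int (card {y. x \<le> y \<and> \<eta> y = c})"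

text \<open>
  Position of the unique second-class particle, with the value \<open>-1\<close> if it has left the system.
\<close>

definition second_class_pos :: "config \<Rightarrow> int" where
  "second_class_pos \<eta> =
     (if \<exists>x\<ge>1. \<eta> x = 2 then int (THE x. 1 \<le> x \<and> \<eta> x = 2) else - 1)"

end

theory Submission
  imports Defs
begin

text \<open>
  Write \<open>h\<^sub>A(x)\<close> for the number of particles of colour at most \<open>c\<close> at sites \<open>\<ge> x\<close> of a
  configuration \<open>A\<close>. Merging colours turns the dynamics into one on height functions, in which a
  ring of clock \<open>i\<close> replaces \<open>h(i + 1)\<close> by \<open>min (h(i)) (h(i + 2) + 1)\<close>, or \<open>h(1)\<close> by \<open>h(2) + 1\<close> if
  \<open>i = 0\<close>. The pairing \<open>D(A, B) = min {h\<^sub>A(x) + h\<^sub>B(x) + x - 1 | x \<ge> 1}\<close> satisfies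
  \<open>D(i A, B) = D(A, i B)\<close>, and pairing \<open>A\<close> with the empty configuration gives the number of particles
  of \<open>A\<close>. Hence the number of particles after a word \<open>w\<close> of rings from \<open>A\<close> is \<open>D(A, B)\<close>, with \<open>B\<close>
  the result of the reversed word from the empty configuration; for the two-shock initial conditions
  the minimum is attained at one of three sites, which yields both claims for every fixed word.
  Independent Poisson clocks have the same law when time is reversed on \<open>[0, t]\<close>, so it remains to
  read off the word of rings: on a fine time grid, with high probability, it is determined by the
  finitely many numbers of rings per cell, whose joint law is invariant under reversing the cells.
\<close>

section \<open>Height functions and their duality\<close>

definition height :: "enat \<Rightarrow> config \<Rightarrow> nat \<Rightarrow> nat" where
  "height c \<eta> x = card {y. x \<le> y \<and> \<eta> y \<le> c}"

text \<open>Finiteness makes the cardinalities in \<open>height\<close> genuine counts, since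
  \<open>card\<close> of an infinite set is 0.\<close>

definition finite_cfg :: "config \<Rightarrow> bool" where
  "finite_cfg \<eta> \<longleftrightarrow> finite {y. \<eta> y \<noteq> \<infinity>}"

lemma finite_cfg_ring_update: "finite_cfg \<eta> \<Longrightarrow> finite_cfg (ring_update i \<eta>)"
  unfolding finite_cfg_def
proof (rule finite_subset)
  show "{y. ring_update i \<eta> y \<noteq> \<infinity>} \<subseteq> {y. \<eta> y \<noteq> \<infinity>} \<union> {i, i + 1, 1}"
    unfolding ring_update_def by (auto simp del: not_infinity_eq split: if_splits)
qed simp

lemma finite_cfg_fold: "finite_cfg \<eta> \<Longrightarrow> finite_cfg (fold ring_update w \<eta>)"
  by (induction w arbitrary: \<eta>) (simp_all add: finite_cfg_ring_update)

lemma finite_cfg_level: "finite_cfg \<eta> \<Longrightarrow> c \<noteq> \<infinity> \<Longrightarrow> finite {y. x \<le> y \<and> \<eta> y \<le> c}"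
  unfolding finite_cfg_def by (erule rev_finite_subset, rule Collect_mono) (metis enat_ord_simps(5))

lemma height_step:
  assumes "finite_cfg \<eta>" "c \<noteq> \<infinity>"
  shows "height c \<eta> x = height c \<eta> (Suc x) + (if \<eta> x \<le> c then 1 else 0)"
proof -
  have "{y. x \<le> y \<and> \<eta> y \<le> c} =
      (if \<eta> x \<le> c then insert x {y. Suc x \<le> y \<and> \<eta> y \<le> c} else {y. Suc x \<le> y \<and> \<eta> y \<le> c})"
    by (auto simp: Suc_le_eq intro: le_neq_implies_less)
  then show ?thesis
    using finite_cfg_level[OF assms, of "Suc x"] by (auto simp: height_def)
qed

lemma height_antimono:
  assumes "finite_cfg \<eta>" "c \<noteq> \<infinity>" "x \<le> y"
  shows "height c \<eta> y \<le> height c \<eta> x"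
  unfolding height_def using finite_cfg_level[OF assms(1,2)] assms(3)
  by (intro card_mono) auto

text \<open>Passing one site loses at most one particle. Together with antitonicity this says that
  heights have slopes 0 or -1, the only geometric input of the duality.\<close>

lemma height_add_mono:
  assumes "finite_cfg \<eta>" "c \<noteq> \<infinity>" "x \<le> y"
  shows "height c \<eta> x + x \<le> height c \<eta> y + y"
  using assms(3)
proof (induction rule: inc_induct)
  case (step n)
  then show ?case using height_step[OF assms(1,2), of n] by (simp split: if_splits)
qed simp

lemma height_cong:
  "(\<And>y. x \<le> y \<Longrightarrow> \<eta> y \<le> c \<longleftrightarrow> \<eta>' y \<le> c) \<Longrightarrow> height c \<eta> x = height c \<eta>' x"
  unfolding height_def by (intro arg_cong[where f = card]) auto

section \<open>Effect of a single ring on heights\<close>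

lemma height_ring_update_above:
  "i + 1 < x \<Longrightarrow> height c (ring_update i \<eta>) x = height c \<eta> x"
  by (intro height_cong) (auto simp: ring_update_def)

lemma height_ring_update_boundary:
  assumes "finite_cfg \<eta>" "c \<noteq> \<infinity>" "1 \<le> c"
  shows "height c (ring_update 0 \<eta>) 1 = height c \<eta> 2 + 1"
proof -
  have "ring_update 0 \<eta> 1 \<le> c"
    using assms(3) by (auto simp: ring_update_def not_less dest: order_trans[OF _ assms(3)])
  then show ?thesis
    using height_step[OF finite_cfg_ring_update[OF assms(1)] assms(2), of 0 1]
      height_ring_update_above[of 0 2 c \<eta>] by (simp add: numeral_2_eq_2)
qed

text \<open>A ring sorts the bond so that the stronger particle ends up at \<open>i + 1\<close>.
  After merging colours at threshold \<open>c\<close>, that site is occupied iff at least one of the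
  two sites was, while the number on the bond is conserved.\<close>

lemma height_ring_update_bond:
  assumes "finite_cfg \<eta>" "c \<noteq> \<infinity>" "i \<ge> 1"
  shows "height c (ring_update i \<eta>) (i + 1) = min (height c \<eta> i) (height c \<eta> (i + 2) + 1)"
    and "height c (ring_update i \<eta>) i = height c \<eta> i"
proof -
  note fin = finite_cfg_ring_update[OF assms(1), of i]
  note above = height_ring_update_above[of i "Suc (Suc i)" c \<eta>]
  note H = height_step[OF assms(1,2), of i] height_step[OF assms(1,2), of "Suc i"]
    height_step[OF fin assms(2), of i] height_step[OF fin assms(2), of "Suc i"]
  show "height c (ring_update i \<eta>) (i + 1) = min (height c \<eta> i) (height c \<eta> (i + 2) + 1)"
    "height c (ring_update i \<eta>) i = height c \<eta> i"
    using H above assms(3) by (auto simp: ring_update_def)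
qed

text \<open>To the right nothing is touched; to the left the exchange conserves the particles on the
  bond. The condition \<open>x \<ge> 1\<close> matters for \<open>i = 0\<close>, where an injected
  particle changes the height at site 0.\<close>

lemma height_ring_update_other:
  assumes "finite_cfg \<eta>" "c \<noteq> \<infinity>" "x \<ge> 1" "x \<noteq> i + 1"
  shows "height c (ring_update i \<eta>) x = height c \<eta> x"
proof (cases "x > i + 1")
  case True
  then show ?thesis by (rule height_ring_update_above)
next
  case False
  then have "x \<le> i" "i \<ge> 1" using assms by auto
  from this(1) show ?thesis
  proof (induction rule: inc_induct)
    case base
    show ?case using height_ring_update_bond(2)[OF assms(1,2) \<open>i \<ge> 1\<close>] .
  next
    case (step n)
    then show ?case
      using height_step[OF assms(1,2), of n] assms(3)
        height_step[OF finite_cfg_ring_update[OF assms(1)] assms(2), of i n]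
      by (auto simp: ring_update_def)
  qed
qed

text \<open>
  A ring of clock \<open>i\<close> changes the height at \<open>i + 1\<close> only, and there to a value that is dominated by
  the constraints at the neighbouring sites.  The right-hand side being symmetric in the two
  configurations, the ring can be moved from one configuration to the other.
\<close>

lemma height_sum_ring_update:
  assumes "finite_cfg \<eta>" "finite_cfg \<eta>'" "c \<noteq> \<infinity>" "d \<noteq> \<infinity>" "1 \<le> c"
  shows "(\<forall>x\<ge>1. m < height c (ring_update i \<eta>) x + height d \<eta>' x + x) \<longleftrightarrow>
         (\<forall>x\<ge>1. x \<noteq> i + 1 \<longrightarrow> m < height c \<eta> x + height d \<eta>' x + x)" (is "?L \<longleftrightarrow> ?R")
proof
  assume ?L
  then show ?R using height_ring_update_other[OF assms(1,3)] by metis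
next
  assume R: ?R
  note mono = height_antimono[OF assms(2,4), of "i + 1" "i + 2"]
  show ?L
  proof (intro allI impI)
    fix x :: nat assume x: "x \<ge> 1"
    show "m < height c (ring_update i \<eta>) x + height d \<eta>' x + x"
    proof (cases "x = i + 1")
      case False
      then show ?thesis using R x height_ring_update_other[OF assms(1,3) x] by simp
    next
      case [simp]: True
      have 2: "m < height c \<eta> (i + 2) + height d \<eta>' (i + 2) + (i + 2)"
        using R[rule_format, of "i + 2"] by simp
      show ?thesis
      proof (cases "i = 0")
        case [simp]: True
        \<comment> \<open>The new height \<open>height c \<eta> 2 + 1\<close> at site 1 is dominated
          by the constraint at site 2, as \<open>height d \<eta>'\<close> decreases.\<close>
        show ?thesis
          using 2 mono height_ring_update_boundary[OF assms(1,3,5)] by (simp add: numeral_2_eq_2)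
      next
        case False
        then have i: "i \<ge> 1" by simp
        \<comment> \<open>The new height is a minimum. Its entry \<open>height c \<eta> i\<close> is
          handled by the constraint at \<open>i\<close>, because height plus position increases; its
          entry \<open>height c \<eta> (i + 2) + 1\<close> by the constraint at
          \<open>i + 2\<close>, because the height decreases.\<close>
        have "m < height c \<eta> i + height d \<eta>' i + i" using R i by auto
        moreover have "height d \<eta>' i + i \<le> height d \<eta>' (i + 1) + (i + 1)"
          by (intro height_add_mono[OF assms(2,4)]) simp
        ultimately show ?thesis
          using 2 mono height_ring_update_bond(1)[OF assms(1,3) i] by simp
      qed
    qed
  qed
qed

text \<open>Rings are moved across one at a time. The first letter of \<open>w\<close> is the last
  to be moved, so it acts last on the other side; hence the reversed word. Quantified lower bounds
  replace the minimum over infinitely many sites.\<close>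

lemma height_sum_fold:
  assumes "finite_cfg \<eta>" "finite_cfg \<eta>'" "c \<noteq> \<infinity>" "d \<noteq> \<infinity>" "1 \<le> c" "1 \<le> d"
  shows "(\<forall>x\<ge>1. m < height c (fold ring_update w \<eta>) x + height d \<eta>' x + x) \<longleftrightarrow>
         (\<forall>x\<ge>1. m < height c \<eta> x + height d (fold ring_update (rev w) \<eta>') x + x)"
  using assms(1,2)
proof (induction w arbitrary: \<eta> \<eta>')
  case (Cons i w)
  let ?\<eta>' = "fold ring_update (rev w) \<eta>'"
  have "(\<forall>x\<ge>1. m < height c (fold ring_update (i # w) \<eta>) x + height d \<eta>' x + x) \<longleftrightarrow>
        (\<forall>x\<ge>1. m < height c (ring_update i \<eta>) x + height d ?\<eta>' x + x)"
    using Cons by (simp add: finite_cfg_ring_update)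
  also have "\<dots> \<longleftrightarrow> (\<forall>x\<ge>1. x \<noteq> i + 1 \<longrightarrow> m < height c \<eta> x + height d ?\<eta>' x + x)"
    using Cons.prems assms by (intro height_sum_ring_update finite_cfg_fold)
  also have "\<dots> \<longleftrightarrow> (\<forall>x\<ge>1. m < height d (ring_update i ?\<eta>') x + height c \<eta> x + x)"
    using height_sum_ring_update[of ?\<eta>' \<eta> d c m i] Cons.prems assms finite_cfg_fold
    by (simp add: add.commute)
  finally show ?case by (simp add: add.commute)
qed simp

lemma empty_init_cfg:
  "finite_cfg empty_init" "c \<noteq> \<infinity> \<Longrightarrow> height c empty_init x = 0"
  by (auto simp: finite_cfg_def empty_init_def height_def)

text \<open>Against the empty configuration the pairing is \<open>height + x\<close>, which is
  smallest at \<open>x = 1\<close>; there \<open>m < height + 1\<close> means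
  \<open>m \<le> height\<close>. The dual process starts empty and only first-class particles enter
  it, so threshold 1 serves on its side.\<close>

lemma height_duality:
  assumes "finite_cfg \<eta>" "c \<noteq> \<infinity>" "1 \<le> c"
  shows "m \<le> height c (fold ring_update w \<eta>) 1 \<longleftrightarrow>
    (\<forall>x\<ge>1. m < height c \<eta> x + height 1 (fold ring_update (rev w) empty_init) x + x)"
proof -
  have fin: "finite_cfg (fold ring_update w \<eta>)" using assms by (simp add: finite_cfg_fold)
  have "m \<le> height c (fold ring_update w \<eta>) 1 \<longleftrightarrow>
        (\<forall>x\<ge>1. m < height c (fold ring_update w \<eta>) x + height 1 empty_init x + x)" (is "?L \<longleftrightarrow> ?R")
  proof
    assume ?L
    show ?R
    proof (intro allI impI)
      fix x :: nat assume "x \<ge> 1"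
      then show "m < height c (fold ring_update w \<eta>) x + height 1 empty_init x + x"
        using \<open>?L\<close> height_add_mono[OF fin assms(2), of 1 x] by simp
    qed
  next
    assume ?R
    then show ?L using empty_init_cfg(2)[of 1 1] by (auto dest!: spec[of _ 1])
  qed
  then show ?thesis
    using height_sum_fold[of \<eta> empty_init c 1 m w] assms empty_init_cfg by simp
qed

section \<open>The two-shock initial conditions\<close>

text \<open>The type \<open>enat\<close> contains the spurious colour 0, which heights would count;
  its absence identifies \<open>height 1\<close> with the number of first-class particles.\<close>

lemma ring_update_nonzero: "(\<And>y. \<eta> y \<noteq> 0) \<Longrightarrow> ring_update i \<eta> y \<noteq> 0"
  by (simp add: ring_update_def)

lemma fold_ring_update_nonzero: "(\<And>y. \<eta> y \<noteq> 0) \<Longrightarrow> fold ring_update w \<eta> y \<noteq> 0"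
proof (induction w arbitrary: \<eta>)
  case (Cons i w)
  then show ?case by (simp add: ring_update_nonzero)
qed simp

lemma num_ge_eq_height_diff:
  assumes "finite_cfg \<eta>"
  shows "num_ge (enat (Suc n)) x \<eta> = int (height (enat (Suc n)) \<eta> x) - int (height (enat n) \<eta> x)"
proof -
  have *: "e = enat (Suc n) \<longleftrightarrow> e \<le> enat (Suc n) \<and> \<not> e \<le> enat n" for e
    by (cases e) auto
  have "{y. x \<le> y \<and> \<eta> y = enat (Suc n)} =
      {y. x \<le> y \<and> \<eta> y \<le> enat (Suc n)} - {y. x \<le> y \<and> \<eta> y \<le> enat n}"
    unfolding * by blast
  moreover have "{y. x \<le> y \<and> \<eta> y \<le> enat n} \<subseteq> {y. x \<le> y \<and> \<eta> y \<le> enat (Suc n)}"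
    by (auto elim: order_trans)
  ultimately show ?thesis
    using finite_cfg_level[OF assms, of "enat n" x] finite_cfg_level[OF assms, of "enat (Suc n)" x]
    by (simp add: num_ge_def height_def card_Diff_subset of_nat_diff card_mono)
qed

lemma num_ge_heights:
  assumes "finite_cfg \<eta>" "\<And>y. \<eta> y \<noteq> 0"
  shows "num_ge 1 x \<eta> = int (height 1 \<eta> x)"
    and "num_ge 2 x \<eta> = int (height 2 \<eta> x) - int (height 1 \<eta> x)"
    and "num_ge 3 x \<eta> = int (height 3 \<eta> x) - int (height 2 \<eta> x)"
proof -
  have "height 0 \<eta> x = 0" using assms(2) by (simp add: height_def)
  then show "num_ge 1 x \<eta> = int (height 1 \<eta> x)"
    using num_ge_eq_height_diff[OF assms(1), of 0 x]
    by (simp add: one_enat_def zero_enat_def)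
  show "num_ge 2 x \<eta> = int (height 2 \<eta> x) - int (height 1 \<eta> x)"
    using num_ge_eq_height_diff[OF assms(1), of 1 x]
    by (simp add: one_enat_def numeral_eq_enat numeral_2_eq_2)
  show "num_ge 3 x \<eta> = int (height 3 \<eta> x) - int (height 2 \<eta> x)"
    using num_ge_eq_height_diff[OF assms(1), of 2 x]
    by (simp add: numeral_eq_enat numeral_3_eq_3 numeral_2_eq_2)
qed

text \<open>Truncated subtraction lets one formula cover every position of \<open>x\<close> relative
  to the blocks, and also empty blocks, which are used below for fewer than two blocks.\<close>

lemma height_two_blocks:
  assumes "\<And>y. y \<ge> 1 \<Longrightarrow> \<eta> y \<le> e \<longleftrightarrow> y \<in> {a..<b} \<union> {c..<d}" "b \<le> c" "x \<ge> 1"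
  shows "height e \<eta> x = (b - max x a) + (d - max x c)"
proof -
  have "{y. x \<le> y \<and> \<eta> y \<le> e} = {max x a..<b} \<union> {max x c..<d}"
    using assms by auto
  moreover have "{max x a..<b} \<inter> {max x c..<d} = {}" using assms(2) by auto
  ultimately show ?thesis by (simp add: height_def card_Un_disjoint)
qed

text \<open>
  Along an empty stretch the minimised quantity increases and along an occupied one it decreases,
  so that only the site \<open>1\<close> and the right ends of the two blocks matter.
\<close>

lemma height_fold_two_blocks:
  fixes \<eta> :: config and w :: "nat list"
  defines "S \<equiv> height 1 (fold ring_update (rev w) empty_init)"
  assumes "finite_cfg \<eta>" "e \<noteq> \<infinity>" "1 \<le> e"
    and blocks: "\<And>y. y \<ge> 1 \<Longrightarrow> \<eta> y \<le> e \<longleftrightarrow> y \<in> {a..<b} \<union> {c..<d}"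
    and ord: "1 \<le> a" "a \<le> b" "b \<le> c" "c \<le> d"
  shows "height e (fold ring_update w \<eta>) 1 =
    min (b - a + (d - c) + S 1) (min (d - c + S b + b - 1) (S d + d - 1))"
proof -
  have fin: "finite_cfg (fold ring_update (rev w) empty_init)"
    by (simp add: finite_cfg_fold empty_init_cfg)
  have anti: "S y \<le> S x" and mono: "S x + x \<le> S y + y" if "x \<le> y" for x y
    using height_antimono[OF fin _ that, of 1] height_add_mono[OF fin _ that, of 1]
    by (simp_all add: S_def)
  let ?h = "\<lambda>x. (b - max x a) + (d - max x c)"
  \<comment> \<open>Two numbers with the same lower bounds \<open>m\<close> are equal, and duality
    speaks about lower bounds.\<close>
  have key: "m \<le> height e (fold ring_update w \<eta>) 1 \<longleftrightarrow> m \<le>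
    min (b - a + (d - c) + S 1) (min (d - c + S b + b - 1) (S d + d - 1))" for m
  proof -
    have "m \<le> height e (fold ring_update w \<eta>) 1 \<longleftrightarrow> (\<forall>x\<ge>1. m < height e \<eta> x + S x + x)"
      unfolding S_def using assms by (intro height_duality)
    also have "\<dots> \<longleftrightarrow> (\<forall>x\<ge>1. m < ?h x + S x + x)"
      using height_two_blocks[OF blocks ord(3)] by simp
    also have "\<dots> \<longleftrightarrow> m < ?h 1 + S 1 + 1 \<and> m < ?h b + S b + b \<and> m < ?h d + S d + d" (is "_ \<longleftrightarrow> ?R")
    proof
      assume ?R
      show "\<forall>x\<ge>1. m < ?h x + S x + x"
      proof (intro allI impI)
        fix x :: nat assume x: "x \<ge> 1"
        consider "x \<le> a" | "a \<le> x" "x \<le> b" | "b \<le> x" "x \<le> c" | "c \<le> x" "x \<le> d" | "d \<le> x"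
          by linarith
        then show "m < ?h x + S x + x"
        proof cases
          case 1
          then show ?thesis using \<open>?R\<close> ord mono[of 1 x] x by (simp add: max_absorb2) linarith
        next
          case 2
          then show ?thesis using \<open>?R\<close> ord anti[of x b] by (simp add: max_absorb1 max_absorb2) linarith
        next
          case 3
          then show ?thesis using \<open>?R\<close> ord mono[of b x] by (simp add: max_absorb1 max_absorb2) linarith
        next
          case 4
          then show ?thesis using \<open>?R\<close> ord anti[of x d] by (simp add: max_absorb1 max_absorb2)
        next
          case 5
          then show ?thesis using \<open>?R\<close> ord mono[of d x] by simp
        qed
      qed
    next
      assume *: "\<forall>x\<ge>1. m < ?h x + S x + x"
      show ?R using *[rule_format, of 1] *[rule_format, of b] *[rule_format, of d] ord by simp
    qed
    \<comment> \<open>Since \<open>b\<close> and \<open>d\<close> are at least 1, the strict bounds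
      become weak ones with a genuine subtraction of 1.\<close>
    also have "\<dots> \<longleftrightarrow> m \<le> min (b - a + (d - c) + S 1) (min (d - c + S b + b - 1) (S d + d - 1))"
      using ord by (auto simp: max_def)
    finally show ?thesis .
  qed
  show ?thesis using key order_antisym order_refl by metis
qed

section \<open>Evaluation for the two concrete initial conditions\<close>

lemma xi_init_cfg: "finite_cfg (xi_init M N)" "xi_init M N y \<noteq> 0"
proof -
  have "{y. xi_init M N y \<noteq> \<infinity>} \<subseteq> {..2 * N + 2 * M + 1}"
    unfolding xi_init_def by (auto simp del: not_infinity_eq split: if_splits)
  then show "finite_cfg (xi_init M N)" unfolding finite_cfg_def by (rule finite_subset) simp
  show "xi_init M N y \<noteq> 0" by (simp add: xi_init_def)
qed

lemma xi_tilde_init_cfg: "finite_cfg (xi_tilde_init M N)" "xi_tilde_init M N y \<noteq> 0"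
proof -
  have "{y. xi_tilde_init M N y \<noteq> \<infinity>} \<subseteq> {..2 * N + 2 * M + 1}"
    unfolding xi_tilde_init_def by (auto simp del: not_infinity_eq split: if_splits)
  then show "finite_cfg (xi_tilde_init M N)" unfolding finite_cfg_def by (rule finite_subset) simp
  show "xi_tilde_init M N y \<noteq> 0" by (simp add: xi_tilde_init_def)
qed

lemma enat_numeral_le:
  "\<not> (2::enat) \<le> 1" "\<not> (3::enat) \<le> 1" "\<not> (3::enat) \<le> 2" "(1::enat) \<le> 2" "(1::enat) \<le> 3" "(2::enat) \<le> 3"
  "(1::enat) \<noteq> \<infinity>" "(2::enat) \<noteq> \<infinity>" "(3::enat) \<noteq> \<infinity>" "\<not> \<infinity> \<le> (1::enat)" "\<not> \<infinity> \<le> (2::enat)" "\<not> \<infinity> \<le> (3::enat)"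
  by (simp_all add: one_enat_def numeral_eq_enat)

text \<open>Raising the threshold from 1 to 2 lengthens the second block by one site at its left
  end: the first two candidates for the minimum grow by 1, while the third, at the right end of that
  block, is unchanged.\<close>

lemma height_xi:
  fixes M N w
  defines "S \<equiv> height 1 (fold ring_update (rev w) empty_init)"
  shows "height 1 (fold ring_update w (xi_init M N)) 1 =
      min (M + N + S 1) (min (2 * N + M + S (N + M + 1)) (2 * N + 2 * M + 1 + S (2 * N + 2 * M + 2)))"
    and "height 2 (fold ring_update w (xi_init M N)) 1 =
      min (M + N + 1 + S 1) (min (2 * N + M + 1 + S (N + M + 1)) (2 * N + 2 * M + 1 + S (2 * N + 2 * M + 2)))"
proof -
  show "height 1 (fold ring_update w (xi_init M N)) 1 =
      min (M + N + S 1) (min (2 * N + M + S (N + M + 1)) (2 * N + 2 * M + 1 + S (2 * N + 2 * M + 2)))"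
    unfolding S_def
    by (subst height_fold_two_blocks[OF xi_init_cfg(1), where a = "N + 1" and b = "N + M + 1"
          and c = "N + 2 * M + 2" and d = "2 * N + 2 * M + 2"])
      (auto simp: xi_init_def enat_numeral_le)
  show "height 2 (fold ring_update w (xi_init M N)) 1 =
      min (M + N + 1 + S 1) (min (2 * N + M + 1 + S (N + M + 1)) (2 * N + 2 * M + 1 + S (2 * N + 2 * M + 2)))"
    unfolding S_def
    by (subst height_fold_two_blocks[OF xi_init_cfg(1), where a = "N + 1" and b = "N + M + 1"
          and c = "N + 2 * M + 1" and d = "2 * N + 2 * M + 2"])
      (auto simp: xi_init_def enat_numeral_le)
qed

lemma height_xi_tilde:
  fixes M N w
  defines "S \<equiv> height 1 (fold ring_update (rev w) empty_init)"
  shows "height 1 (fold ring_update w (xi_tilde_init M N)) 1 = S 1"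
    and "height 2 (fold ring_update w (xi_tilde_init M N)) 1 = min (M + S 1) (N + M + S (N + M + 1))"
    and "height 3 (fold ring_update w (xi_tilde_init M N)) 1 =
      min (M + N + 1 + S 1) (min (2 * N + M + 1 + S (N + M + 1)) (2 * N + 2 * M + 1 + S (2 * N + 2 * M + 2)))"
proof -
  show "height 1 (fold ring_update w (xi_tilde_init M N)) 1 = S 1"
    unfolding S_def
    \<comment> \<open>Initially there are no first-class particles: both blocks are empty at site 1,
      and all three candidates equal \<open>S 1\<close>.\<close>
    by (subst height_fold_two_blocks[OF xi_tilde_init_cfg(1), where a = 1 and b = 1 and c = 1 and d = 1])
      (auto simp: xi_tilde_init_def enat_numeral_le)
  show "height 2 (fold ring_update w (xi_tilde_init M N)) 1 = min (M + S 1) (N + M + S (N + M + 1))"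
    unfolding S_def
    \<comment> \<open>There is only one block; the second is taken empty at the right end of the
      first, so that the last two candidates coincide.\<close>
    by (subst height_fold_two_blocks[OF xi_tilde_init_cfg(1), where a = "N + 1" and b = "N + M + 1"
          and c = "N + M + 1" and d = "N + M + 1"])
      (auto simp: xi_tilde_init_def enat_numeral_le)
  show "height 3 (fold ring_update w (xi_tilde_init M N)) 1 =
      min (M + N + 1 + S 1) (min (2 * N + M + 1 + S (N + M + 1)) (2 * N + 2 * M + 1 + S (2 * N + 2 * M + 2)))"
    unfolding S_def
    by (subst height_fold_two_blocks[OF xi_tilde_init_cfg(1), where a = "N + 1" and b = "N + M + 1"
          and c = "N + 2 * M + 1" and d = "2 * N + 2 * M + 2"])
      (auto simp: xi_tilde_init_def enat_numeral_le)
qed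

lemma second_class_pos_neg_iff:
  assumes "finite_cfg \<eta>" "\<And>y. \<eta> y \<noteq> 0"
  shows "second_class_pos \<eta> < 0 \<longleftrightarrow> height 2 \<eta> 1 = height 1 \<eta> 1"
proof -
  have "finite {y. 1 \<le> y \<and> \<eta> y = 2}"
    by (rule finite_subset[OF _ finite_cfg_level[OF assms(1), of 2 1]]) (auto simp: enat_numeral_le)
  then have "num_ge 2 1 \<eta> = 0 \<longleftrightarrow> \<not> (\<exists>x\<ge>1. \<eta> x = 2)"
    by (simp add: num_ge_def)
  \<comment> \<open>The value in the other branch is the image of a natural number, hence
    nonnegative whatever \<open>THE\<close> denotes.\<close>
  moreover have "second_class_pos \<eta> < 0 \<longleftrightarrow> \<not> (\<exists>x\<ge>1. \<eta> x = 2)"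
    by (simp add: second_class_pos_def)
  ultimately show ?thesis using num_ge_heights(2)[OF assms, of 1] by auto
qed

lemma empty_fold_num_ge:
  "num_ge 1 x (fold ring_update w empty_init) = int (height 1 (fold ring_update w empty_init) x)"
  by (intro num_ge_heights finite_cfg_fold fold_ring_update_nonzero empty_init_cfg)
    (simp add: empty_init_def)

text \<open>By \<open>height_xi\<close> the two totals are \<open>min A (min B C)\<close> and
  \<open>min (A + 1) (min (B + 1) C)\<close>. They agree iff \<open>C \<le> A\<close> and
  \<open>C \<le> B\<close>, and these two inequalities are the two cases of the minimum in the
  stated condition.\<close>

lemma xi_left_iff:
  fixes M N w
  defines "S \<equiv> \<lambda>x. num_ge 1 x (fold ring_update (rev w) empty_init)"
  shows "second_class_pos (fold ring_update w (xi_init M N)) < 0 \<longleftrightarrow>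
    S (N + M + 1) - S (2 * N + 2 * M + 2) + min (int N) (S 1 - S (N + M + 1)) \<ge> int N + int M + 1"
proof -
  have "second_class_pos (fold ring_update w (xi_init M N)) < 0 \<longleftrightarrow>
      height 2 (fold ring_update w (xi_init M N)) 1 = height 1 (fold ring_update w (xi_init M N)) 1"
    by (intro second_class_pos_neg_iff finite_cfg_fold fold_ring_update_nonzero xi_init_cfg)
  then show ?thesis
    unfolding height_xi S_def empty_fold_num_ge by linarith
qed

lemma xi_tilde_counts:
  fixes M N w
  defines "S \<equiv> \<lambda>x. num_ge 1 x (fold ring_update (rev w) empty_init)"
    and "\<eta> \<equiv> fold ring_update w (xi_tilde_init M N)"
  shows "(num_ge 1 1 \<eta>, num_ge 2 1 \<eta>, num_ge 3 1 \<eta>) =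
    (S 1, min (int M) (int M + int N - S 1 + S (M + N + 1)),
     min (int N + 1) (int M + int N + 1 - S (M + N + 1) + S (2 * M + 2 * N + 2)
        + max 0 (int N - S 1 + S (M + N + 1))))"
proof -
  have \<eta>: "finite_cfg \<eta>" "\<eta> y \<noteq> 0" for y
    unfolding \<eta>_def by (intro finite_cfg_fold fold_ring_update_nonzero xi_tilde_init_cfg)+
  have comm: "M + N + 1 = N + M + 1" "2 * M + 2 * N + 2 = 2 * N + 2 * M + 2" by simp_all
  show ?thesis
    unfolding num_ge_heights[OF \<eta>]
    unfolding S_def empty_fold_num_ge \<eta>_def height_xi_tilde prod.inject comm
    \<comment> \<open>For the third count, the first two candidates of \<open>height 3\<close> have
      minimum \<open>height 2 + N + 1\<close>; subtracting \<open>height 2\<close> from the third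
      candidate turns the minimum in \<open>height 2\<close> into the maximum with 0.\<close>
    by (intro conjI) linarith+
qed

section \<open>Trajectories and words of rings\<close>

lemma driven_path_left_limit:
  assumes "driven_path R \<eta>0 \<eta>" "t > 0"
  obtains \<zeta> where "\<And>x. \<forall>\<^sub>F s in at_left t. \<eta> s x = \<zeta> x"
    "\<And>i. t \<in> R i \<Longrightarrow> \<eta> t = ring_update i \<zeta>" "(\<And>i. t \<notin> R i) \<Longrightarrow> \<eta> t = \<zeta>"
  using assms unfolding driven_path_def by blast

lemma ring_update_away: "i \<noteq> x \<Longrightarrow> Suc i \<noteq> x \<Longrightarrow> ring_update i \<eta> x = \<eta> x"
  by (auto simp: ring_update_def)

text \<open>Right-continuity gives local constancy to the right. To the left, the limit at
  \<open>x\<close> equals the value because no ring at that time acts on \<open>x\<close>.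
  Connectedness of the interval does the rest.\<close>

lemma driven_path_constant:
  assumes dp: "driven_path R \<eta>0 \<eta>" and ab: "0 \<le> a" "a \<le> b"
    and quiet: "\<And>s i. a < s \<Longrightarrow> s \<le> b \<Longrightarrow> s \<in> R i \<Longrightarrow> i \<noteq> x \<and> Suc i \<noteq> x"
  shows "\<eta> b x = \<eta> a x"
proof (cases "a = b")
  case False
  then have "a < b" using ab by simp
  have ev: "\<forall>\<^sub>F u in at s within {a..b}. \<eta> u x = \<eta> s x" if s: "s \<in> {a..b}" for s
  proof -
    have right: "\<forall>\<^sub>F u in at_right s. \<eta> u x = \<eta> s x"
      using dp ab s unfolding driven_path_def by auto
    show ?thesis
    proof (cases "s = a")
      case True
      then show ?thesis using right at_within_Icc_at_right[OF \<open>a < b\<close>] by simp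
    next
      case False
      then have "s > a" "s > 0" using s ab by auto
      obtain \<zeta> where \<zeta>: "\<And>y. \<forall>\<^sub>F u in at_left s. \<eta> u y = \<zeta> y"
        "\<And>i. s \<in> R i \<Longrightarrow> \<eta> s = ring_update i \<zeta>" "(\<And>i. s \<notin> R i) \<Longrightarrow> \<eta> s = \<zeta>"
        using driven_path_left_limit[OF dp \<open>s > 0\<close>] by blast
      have "\<eta> s x = \<zeta> x"
      proof (cases "\<exists>i. s \<in> R i")
        case True
        then obtain i where "s \<in> R i" by blast
        then show ?thesis
          using \<zeta>(2)[of i] quiet[of s i] \<open>s > a\<close> s by (simp add: ring_update_away)
      next
        case False
        then show ?thesis using \<zeta>(3) by simp
      qed
      then have "\<forall>\<^sub>F u in at s. \<eta> u x = \<eta> s x"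
        using \<zeta>(1)[of x] right by (simp add: eventually_at_split)
      then show ?thesis by (rule filter_leD[OF at_le, rotated]) simp
    qed
  qed
  have "(\<lambda>s. \<eta> s x) constant_on {a..b}"
  proof (rule locally_constant_imp_constant)
    fix s assume s: "s \<in> {a..b}"
    from ev[OF s] obtain U where "open U" "s \<in> U" "\<forall>u\<in>U. u \<noteq> s \<longrightarrow> u \<in> {a..b} \<longrightarrow> \<eta> u x = \<eta> s x"
      unfolding eventually_at_topological by blast
    then show "\<exists>T. openin (top_of_set {a..b}) T \<and> s \<in> T \<and> (\<forall>u\<in>T. \<eta> u x = \<eta> s x)"
      using s by (intro exI[of _ "{a..b} \<inter> U"]) (auto simp: openin_open)
  qed simp
  then show ?thesis using ab unfolding constant_on_def by (metis atLeastAtMost_iff order_refl)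
qed simp

text \<open>A ring at time \<open>b\<close> itself is allowed here: this computes the configuration
  just before a ring.\<close>

lemma driven_path_left_constant:
  assumes dp: "driven_path R \<eta>0 \<eta>" and "0 \<le> a" "a < b"
    and quiet: "\<And>s i. a < s \<Longrightarrow> s < b \<Longrightarrow> s \<in> R i \<Longrightarrow> i \<noteq> x \<and> Suc i \<noteq> x"
    and lim: "\<forall>\<^sub>F s in at_left b. \<eta> s x = z"
  shows "z = \<eta> a x"
proof -
  have "\<forall>\<^sub>F s in at_left b. \<eta> s x = \<eta> a x"
  proof (rule eventually_at_leftI[OF _ \<open>a < b\<close>])
    fix s assume "s \<in> {a<..<b}"
    then show "\<eta> s x = \<eta> a x"
      using quiet by (intro driven_path_constant[OF dp assms(2)]) auto
  qed
  with lim have "\<forall>\<^sub>F s in at_left b. z = \<eta> a x" by eventually_elim simp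
  then show ?thesis by simp
qed

text \<open>
  A silent bond keeps the sites to its right empty, even though infinitely many clocks act there:
  the first site to be filled would have to be filled from the left.
\<close>

lemma driven_path_empty_beyond:
  assumes dp: "driven_path R \<eta>0 \<eta>" and init: "\<And>y. y > j \<Longrightarrow> \<eta>0 y = \<infinity>"
    and silent: "R j \<inter> {0<..T} = {}"
  shows "y > j \<Longrightarrow> s \<in> {0..T} \<Longrightarrow> \<eta> s y = \<infinity>"
proof (induction y arbitrary: s)
  case (Suc y)
  show ?case
  proof (rule ccontr)
    assume nonempty: "\<eta> s (Suc y) \<noteq> \<infinity>"
    define E where "E = {u\<in>{0..T}. \<eta> u (Suc y) \<noteq> \<infinity>}"
    define \<tau> where "\<tau> = Inf E"
    have "s \<in> E" using nonempty Suc.prems by (simp add: E_def)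
    have bdd: "bdd_below E" unfolding E_def by (rule bdd_belowI[of _ 0]) simp
    have \<tau>: "\<tau> \<le> s" "0 \<le> \<tau>"
      unfolding \<tau>_def using \<open>s \<in> E\<close> by (auto intro!: cInf_lower cInf_greatest bdd simp: E_def)
    have before: "\<eta> u (Suc y) = \<infinity>" if "0 \<le> u" "u < \<tau>" for u
      using that \<tau> Suc.prems cInf_lower[OF _ bdd, of u] unfolding \<tau>_def E_def by force
    \<comment> \<open>The infimum is attained: otherwise right-continuity keeps the site empty up to
      some \<open>b > \<tau>\<close>, a larger lower bound of \<open>E\<close>.\<close>
    have at: "\<eta> \<tau> (Suc y) \<noteq> \<infinity>"
    proof
      assume *: "\<eta> \<tau> (Suc y) = \<infinity>"
      then have "\<forall>\<^sub>F u in at_right \<tau>. \<eta> u (Suc y) = \<infinity>"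
        using dp \<tau>(2) unfolding driven_path_def by metis
      then obtain b where "b > \<tau>" and after: "\<And>u. \<tau> < u \<Longrightarrow> u < b \<Longrightarrow> \<eta> u (Suc y) = \<infinity>"
        by (auto simp: eventually_at_right_field)
      have "u \<ge> b" if "u \<in> E" for u
      proof (rule ccontr)
        assume "\<not> u \<ge> b"
        then have "\<eta> u (Suc y) = \<infinity>"
          using * before[of u] after[of u] that by (cases u \<tau> rule: linorder_cases) (auto simp: E_def)
        then show False using that by (simp add: E_def)
      qed
      then have "b \<le> \<tau>" unfolding \<tau>_def using \<open>s \<in> E\<close> by (intro cInf_greatest) auto
      with \<open>b > \<tau>\<close> show False by simp
    qed
    have "\<eta> 0 = \<eta>0" using dp by (simp add: driven_path_def)
    then have "\<tau> > 0" using at init[of "Suc y"] Suc.prems \<tau> by (cases "\<tau> = 0") auto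
    obtain \<zeta> where \<zeta>: "\<And>x. \<forall>\<^sub>F u in at_left \<tau>. \<eta> u x = \<zeta> x"
      "\<And>i. \<tau> \<in> R i \<Longrightarrow> \<eta> \<tau> = ring_update i \<zeta>" "(\<And>i. \<tau> \<notin> R i) \<Longrightarrow> \<eta> \<tau> = \<zeta>"
      using driven_path_left_limit[OF dp \<open>\<tau> > 0\<close>] by blast
    have lim: "\<zeta> x = \<infinity>" if "\<And>u. 0 < u \<Longrightarrow> u < \<tau> \<Longrightarrow> \<eta> u x = \<infinity>" for x
    proof -
      have "\<forall>\<^sub>F u in at_left \<tau>. \<eta> u x = \<infinity>"
        using that by (intro eventually_at_leftI[OF _ \<open>\<tau> > 0\<close>]) auto
      with \<zeta>(1)[of x] have "\<forall>\<^sub>F u in at_left \<tau>. \<zeta> x = \<infinity>" by eventually_elim simp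
      then show ?thesis by simp
    qed
    have \<zeta>_Suc: "\<zeta> (Suc y) = \<infinity>" using before by (intro lim) simp
    then obtain i where i: "\<tau> \<in> R i" using \<zeta>(3) at by metis
    have "ring_update i \<zeta> (Suc y) \<noteq> \<infinity>" using \<zeta>(2)[OF i] at by simp
    \<comment> \<open>Just before \<tau> the site is empty, so only clock \<open>y\<close> can fill
      it, from an occupied site \<open>y\<close> or, if \<open>y = 0\<close>, from the reservoir. As
      clock \<open>j\<close> is silent, \<open>y > j\<close>, and the induction hypothesis says that
      \<open>y\<close> was empty.\<close>
    then have "i = y" "i \<noteq> 0 \<Longrightarrow> \<zeta> i \<noteq> \<infinity>"
      using \<zeta>_Suc unfolding ring_update_def by (auto simp del: not_infinity_eq split: if_splits)
    moreover have "i \<noteq> j" using silent i \<open>\<tau> > 0\<close> \<tau> Suc.prems by auto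
    ultimately have "y > j" "\<zeta> y \<noteq> \<infinity>" using Suc.prems by auto
    moreover have "\<zeta> y = \<infinity>" using Suc.IH[OF \<open>y > j\<close>] \<tau> Suc.prems by (intro lim) auto
    ultimately show False by simp
  qed
qed simp

text \<open>Sites beyond \<open>j\<close> stay empty, and sites up to \<open>j\<close> are only
  touched by clocks up to \<open>j \<le> L\<close>. Among these at most one ring occurs in the cell,
  so the listed clocks form the empty word or a single letter.\<close>

lemma driven_path_cell:
  assumes dp: "driven_path R \<eta>0 \<eta>" and init: "\<And>y. y > j \<Longrightarrow> \<eta>0 y = \<infinity>"
    and silent: "R j \<inter> {0<..T} = {}" and j: "j \<le> L" and ab: "0 \<le> a" "a < b" "b \<le> T"
    and fin: "\<And>i. i \<le> L \<Longrightarrow> finite (R i \<inter> {a<..b})"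
    and sparse: "(\<Sum>i\<le>L. card (R i \<inter> {a<..b})) \<le> 1"
  shows "\<eta> b = fold ring_update (filter (\<lambda>i. card (R i \<inter> {a<..b}) \<noteq> 0) [0..<Suc L]) (\<eta> a)"
proof -
  let ?C = "\<lambda>i. R i \<inter> {a<..b}"
  let ?w = "filter (\<lambda>i. card (?C i) \<noteq> 0) [0..<Suc L]"
  note empty = driven_path_empty_beyond[OF dp init silent]
  have eqI: "\<eta> b = \<theta>" if "\<And>x. x \<le> j \<Longrightarrow> \<eta> b x = \<theta> x" "\<And>x. x > j \<Longrightarrow> \<theta> x = \<infinity>" for \<theta>
  proof
    fix x show "\<eta> b x = \<theta> x" using that[of x] empty[of x b] ab by (cases "x \<le> j") auto
  qed
  show ?thesis
  proof (cases "\<exists>i\<le>L. card (?C i) \<noteq> 0")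
    case False
    then have "?w = []" by (auto simp: filter_empty_conv)
    have quiet: "?C i = {}" if "i \<le> L" for i using False fin that by (metis card_0_eq)
    have "\<eta> b = \<eta> a"
    proof (rule eqI)
      fix x assume "x \<le> j"
      show "\<eta> b x = \<eta> a x"
      proof (rule driven_path_constant[OF dp])
        fix s k assume "a < s" "s \<le> b" "s \<in> R k"
        then have "s \<in> ?C k" by simp
        with quiet have "\<not> k \<le> L" by blast
        then show "k \<noteq> x \<and> Suc k \<noteq> x" using \<open>x \<le> j\<close> j by auto
      qed (use ab in auto)
    qed (use empty ab in auto)
    with \<open>?w = []\<close> show ?thesis by simp
  next
    case True
    then obtain i where i: "i \<le> L" "card (?C i) \<noteq> 0" by blast
    have "card (?C i) + (\<Sum>k\<in>{..L} - {i}. card (?C k)) \<le> 1"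
      using sparse i(1) by (subst (asm) sum.remove[of _ i]) auto
    with i(2) have one: "card (?C i) = 1" and "(\<Sum>k\<in>{..L} - {i}. card (?C k)) = 0" by linarith+
    then have zero: "card (?C k) = 0" if "k \<le> L" "k \<noteq> i" for k using that by auto
    have "?w = filter (\<lambda>k. k = i) [0..<Suc L]"
    proof (rule filter_cong[OF refl])
      fix k assume "k \<in> set [0..<Suc L]"
      then have "k \<le> L" by auto
      show "card (?C k) \<noteq> 0 \<longleftrightarrow> k = i"
      proof (cases "k = i")
        case True
        then show ?thesis using one by simp
      next
        case False
        then show ?thesis using zero[OF \<open>k \<le> L\<close> False] by simp
      qed
    qed
    also have "\<dots> = [i]"
      using i(1) by (induction L) (auto simp: le_Suc_eq filter_empty_conv)
    finally have w: "?w = [i]" .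
    obtain \<tau> where \<tau>: "?C i = {\<tau>}" using one card_1_singletonE by blast
    \<comment> \<open>Hence the relevant sites are frozen on both sides of \<tau>: the configuration
      just before \<tau> is \<open>\<eta> a\<close>, and the one at \<tau> persists until
      \<open>b\<close>.\<close>
    have rings: "k = i \<and> s = \<tau>" if "s \<in> R k" "k \<le> L" "a < s" "s \<le> b" for k s
    proof -
      have "s \<in> ?C k" using that by simp
      then have "card (?C k) \<noteq> 0" using fin[OF that(2)] card_0_eq by blast
      then have "k = i" using zero[OF that(2)] by linarith
      with \<open>s \<in> ?C k\<close> \<tau> show ?thesis by auto
    qed
    have \<tau>ab: "\<tau> \<in> R i" "a < \<tau>" "\<tau> \<le> b" using \<tau> by auto
    then have "\<tau> > 0" using ab by simp
    obtain \<zeta> where \<zeta>: "\<And>x. \<forall>\<^sub>F u in at_left \<tau>. \<eta> u x = \<zeta> x"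
      "\<And>i. \<tau> \<in> R i \<Longrightarrow> \<eta> \<tau> = ring_update i \<zeta>" "(\<And>i. \<tau> \<notin> R i) \<Longrightarrow> \<eta> \<tau> = \<zeta>"
      using driven_path_left_limit[OF dp \<open>\<tau> > 0\<close>] by blast
    have "\<zeta> = \<eta> a"
    proof
      fix x show "\<zeta> x = \<eta> a x"
      proof (cases "x \<le> j")
      case True
      show ?thesis
      proof (rule driven_path_left_constant[OF dp ab(1) \<tau>ab(2) _ \<zeta>(1)])
        fix s k assume "a < s" "s < \<tau>" "s \<in> R k"
        then show "k \<noteq> x \<and> Suc k \<noteq> x"
          using rings[of s k] \<tau>ab(3) True j by auto
      qed
    next
      case False
      have "\<forall>\<^sub>F u in at_left \<tau>. \<eta> u x = \<infinity>"
        using empty False \<tau>ab ab by (intro eventually_at_leftI[OF _ \<open>\<tau> > 0\<close>]) auto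
      with \<zeta>(1)[of x] have "\<forall>\<^sub>F u in at_left \<tau>. \<zeta> x = \<infinity>" by eventually_elim simp
      then show ?thesis using empty False ab by simp
      qed
    qed
    then have \<eta>\<tau>: "\<eta> \<tau> = ring_update i (\<eta> a)" using \<zeta>(2) \<tau>ab(1) by simp
    have "\<eta> b = \<eta> \<tau>"
    proof (rule eqI)
      fix x assume x: "x \<le> j"
      show "\<eta> b x = \<eta> \<tau> x"
      proof (rule driven_path_constant[OF dp])
        fix s k assume "\<tau> < s" "s \<le> b" "s \<in> R k"
        then show "k \<noteq> x \<and> Suc k \<noteq> x" using rings[of s k] \<tau>ab(2) x j by auto
      qed (use \<tau>ab ab in auto)
    qed (use empty \<tau>ab ab in auto)
    with \<eta>\<tau> w show ?thesis by simp
  qed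
qed

text \<open>Within a cell, clocks that rang are listed once, in increasing order of index; this is
  the true chronological word when no cell contains two rings.\<close>

definition ring_word :: "nat \<Rightarrow> nat \<Rightarrow> (nat \<times> nat \<Rightarrow> nat) \<Rightarrow> nat list" where
  "ring_word L n c = concat (map (\<lambda>k. filter (\<lambda>i. c (i, k) \<noteq> 0) [0..<Suc L]) [0..<n])"

text \<open>
  At most one ring per cell makes the order of the rings visible in the counts; a silent bond
  beyond the support of the initial configuration makes the clocks above \<open>L\<close> irrelevant.
\<close>

definition decodable :: "nat \<Rightarrow> nat \<Rightarrow> nat \<Rightarrow> (nat \<times> nat \<Rightarrow> nat) \<Rightarrow> bool" where
  "decodable K L n c \<longleftrightarrow> (\<forall>k<n. (\<Sum>i\<le>L. c (i, k)) \<le> 1) \<and> (\<exists>j\<in>{K<..L}. \<forall>k<n. c (j, k) = 0)"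

text \<open>Time reversal on the grid: \<open>k \<mapsto> n - Suc k\<close> reflects the cells
  \<open>0, ..., n - 1\<close>, the only ones that are read.\<close>

definition rev_cells :: "nat \<Rightarrow> (nat \<times> nat \<Rightarrow> nat) \<Rightarrow> nat \<times> nat \<Rightarrow> nat" where
  "rev_cells n c = (\<lambda>(i, k). c (i, n - Suc k))"

definition ring_counts :: "(nat \<Rightarrow> real set) \<Rightarrow> (nat \<Rightarrow> real) \<Rightarrow> nat \<times> nat \<Rightarrow> nat" where
  "ring_counts R s = (\<lambda>(i, k). card (R i \<inter> {s k<..s (Suc k)}))"

section \<open>Reading the word of rings off the counts\<close>

lemma ring_word_cong:
  "(\<And>i k. i \<le> L \<Longrightarrow> k < n \<Longrightarrow> c (i, k) = c' (i, k)) \<Longrightarrow> ring_word L n c = ring_word L n c'"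
  unfolding ring_word_def by (intro arg_cong[where f = concat] map_cong filter_cong) auto

lemma decodable_cong:
  assumes "\<And>i k. i \<le> L \<Longrightarrow> k < n \<Longrightarrow> c (i, k) = c' (i, k)"
  shows "decodable K L n c \<longleftrightarrow> decodable K L n c'"
proof -
  have "(\<Sum>i\<le>L. c (i, k)) = (\<Sum>i\<le>L. c' (i, k))" if "k < n" for k
    using assms that by (intro sum.cong) auto
  moreover have "c (j, k) = c' (j, k)" if "j \<in> {K<..L}" "k < n" for j k using assms that by auto
  ultimately show ?thesis unfolding decodable_def by auto
qed

lemma decodable_rev_cells: "decodable K L n (rev_cells n c) \<longleftrightarrow> decodable K L n c"
proof -
  have *: "(\<forall>k<n. Q (n - Suc k)) \<longleftrightarrow> (\<forall>k<n. Q k)" for Q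
  proof (intro iffI allI impI)
    fix k assume "\<forall>k<n. Q (n - Suc k)" "k < n"
    then show "Q k" by (auto dest!: spec[of _ "n - Suc k"])
  qed auto
  show ?thesis
    unfolding decodable_def rev_cells_def
    using *[of "\<lambda>k. (\<Sum>i\<le>L. c (i, k)) \<le> 1"] *[of "\<lambda>k. c (j, k) = 0" for j] by simp
qed

text \<open>Reversing the word reverses the order of the cells and the list inside each cell; a list
  of length at most 1 is its own reverse.\<close>

lemma ring_word_rev_cells:
  assumes "decodable K L n c"
  shows "ring_word L n (rev_cells n c) = rev (ring_word L n c)"
proof -
  let ?f = "\<lambda>k. filter (\<lambda>i. c (i, k) \<noteq> 0) [0..<Suc L]"
  have rev_short: "rev xs = xs" if "length xs \<le> 1" for xs :: "nat list"
    using that by (cases xs) auto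
  have rev_f: "rev (?f k) = ?f k" if "k < n" for k
  proof -
    have "length (?f k) = card {i. i \<le> L \<and> c (i, k) \<noteq> 0}"
      by (subst distinct_card[symmetric])
        (auto intro!: arg_cong[where f = card] distinct_filter simp del: upt_Suc)
    also have "\<dots> = (\<Sum>i\<in>{i. i \<le> L \<and> c (i, k) \<noteq> 0}. 1)" by simp
    also have "\<dots> \<le> (\<Sum>i\<in>{i. i \<le> L \<and> c (i, k) \<noteq> 0}. c (i, k))" by (intro sum_mono) auto
    also have "\<dots> \<le> (\<Sum>i\<le>L. c (i, k))" by (intro sum_mono2) auto
    also have "\<dots> \<le> 1" using assms that by (simp add: decodable_def)
    finally show ?thesis by (rule rev_short)
  qed
  have "rev (ring_word L n c) = concat (map (rev \<circ> ?f) (rev [0..<n]))"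
    by (simp add: ring_word_def rev_concat rev_map)
  also have "rev [0..<n] = map (\<lambda>k. n - Suc k) [0..<n]"
    by (intro nth_equalityI) (auto simp: rev_nth)
  also have "map (rev \<circ> ?f) \<dots> = map (\<lambda>k. ?f (n - Suc k)) [0..<n]"
    using rev_f by simp
  finally show ?thesis by (simp add: ring_word_def rev_cells_def)
qed

lemma driven_path_ring_word:
  fixes T :: real and n :: nat
  defines "s \<equiv> \<lambda>k. T * real k / real n"
  assumes dp: "driven_path R \<eta>0 \<eta>" and init: "\<And>y. y > K \<Longrightarrow> \<eta>0 y = \<infinity>"
    and T: "T > 0" and n: "n > 0"
    and fin: "\<And>i b. finite (R i \<inter> {0<..b})"
    and dec: "decodable K L n (ring_counts R s)"
  shows "\<eta> T = fold ring_update (ring_word L n (ring_counts R s)) \<eta>0"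
proof -
  let ?c = "ring_counts R s"
  have s0: "s 0 = 0" and sn: "s n = T" using n by (simp_all add: s_def)
  have s_less: "s k < s (Suc k)" for k
    using T n by (simp add: s_def field_simps)
  have s_mono: "s k \<le> s l" if "k \<le> l" for k l
    using that T n by (simp add: s_def divide_right_mono)
  have fin': "finite (R i \<inter> {s k<..s (Suc k)})" for i k
    using s_mono[of 0 k] s0 by (intro finite_subset[OF _ fin[of i "s (Suc k)"]]) auto
  obtain j where j: "K < j" "j \<le> L" "\<And>k. k < n \<Longrightarrow> ?c (j, k) = 0"
    using dec unfolding decodable_def by auto
  \<comment> \<open>Silence of clock \<open>j\<close> in every cell adds up to silence on the whole
    interval.\<close>
  have "R j \<inter> {0<..s m} = {}" if "m \<le> n" for m
    using that
  proof (induction m)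
    case (Suc m)
    have "R j \<inter> {s m<..s (Suc m)} = {}"
      using j(3)[of m] Suc.prems fin' by (simp add: ring_counts_def)
    moreover have "{0<..s (Suc m)} \<subseteq> {0<..s m} \<union> {s m<..s (Suc m)}" by auto
    ultimately show ?case using Suc by auto
  qed (simp add: s0)
  from this[of n] have silent: "R j \<inter> {0<..T} = {}" by (simp add: sn)
  have "\<eta> (s m) = fold ring_update (ring_word L m ?c) \<eta>0" if "m \<le> n" for m
    using that
  proof (induction m)
    case 0
    show ?case using dp by (simp add: s0 ring_word_def driven_path_def)
  next
    case (Suc m)
    have "\<eta> (s (Suc m)) = fold ring_update (filter (\<lambda>i. card (R i \<inter> {s m<..s (Suc m)}) \<noteq> 0) [0..<Suc L]) (\<eta> (s m))"
    proof (rule driven_path_cell[OF dp _ silent j(2)])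
      show "0 \<le> s m" using s_mono[of 0 m] s0 by simp
      show "s (Suc m) \<le> T" using s_mono[OF Suc.prems] sn by simp
      show "(\<Sum>i\<le>L. card (R i \<inter> {s m<..s (Suc m)})) \<le> 1"
        using dec Suc.prems unfolding decodable_def ring_counts_def by auto
    qed (use init j(1) s_less fin' in auto)
    then show ?case using Suc by (simp add: ring_word_def ring_counts_def)
  qed
  from this[of n] show ?thesis by (simp add: sn)
qed

section \<open>Rings of Poisson clocks\<close>

text \<open>Finitely many natural-valued variables take countably many joint values, so atoms
  determine their law. The predicate \<open>Q\<close> is defined on total functions, hence the
  requirement that it reads only the indices in \<open>I\<close>.\<close>

lemma joint_law_eqI:
  fixes Y :: "'i \<Rightarrow> 'a \<Rightarrow> nat" and Y' :: "'i \<Rightarrow> 'b \<Rightarrow> nat"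
  assumes "finite I" and meas: "\<And>i. i \<in> I \<Longrightarrow> Y i \<in> measurable \<mu> (count_space UNIV)"
    and meas': "\<And>i. i \<in> I \<Longrightarrow> Y' i \<in> measurable \<mu>' (count_space UNIV)"
    and "prob_space \<mu>" "prob_space \<mu>'"
    and atoms: "\<And>f. measure \<mu> {\<omega> \<in> space \<mu>. \<forall>i\<in>I. Y i \<omega> = f i} = measure \<mu>' {\<omega> \<in> space \<mu>'. \<forall>i\<in>I. Y' i \<omega> = f i}"
    and local: "\<And>c c'. (\<And>i. i \<in> I \<Longrightarrow> c i = c' i) \<Longrightarrow> Q c \<longleftrightarrow> Q c'"
  shows "{\<omega> \<in> space \<mu>. Q (\<lambda>i. Y i \<omega>)} \<in> sets \<mu>"
    and "measure \<mu> {\<omega> \<in> space \<mu>. Q (\<lambda>i. Y i \<omega>)} = measure \<mu>' {\<omega> \<in> space \<mu>'. Q (\<lambda>i. Y' i \<omega>)}"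
proof -
  interpret \<mu>: prob_space \<mu> by fact
  interpret \<mu>': prob_space \<mu>' by fact
  let ?E = "PiE I (\<lambda>_. UNIV :: nat set)"
  let ?F = "\<lambda>\<omega>. \<lambda>i\<in>I. Y i \<omega>" and ?F' = "\<lambda>\<omega>. \<lambda>i\<in>I. Y' i \<omega>"
  have PiM: "PiM I (\<lambda>_. count_space (UNIV :: nat set)) = count_space ?E"
    using \<open>finite I\<close> by (intro count_space_PiM_finite) auto
  have F: "?F \<in> measurable \<mu> (count_space ?E)" and F': "?F' \<in> measurable \<mu>' (count_space ?E)"
    unfolding PiM[symmetric] using meas meas' by (auto intro!: measurable_restrict)
  have "countable ?E" using \<open>finite I\<close> by (intro countable_PiE) auto
  \<comment> \<open>Elements of \<open>?E\<close> are \<open>undefined\<close> outside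
    \<open>I\<close>, so agreement on \<open>I\<close> already means equality.\<close>
  have restrict_eq: "restrict h I = f \<longleftrightarrow> (\<forall>i\<in>I. h i = f i)" if "f \<in> ?E" for f h :: "'i \<Rightarrow> nat"
    using extensional_arb[of f I] that unfolding PiE_def by (auto simp: fun_eq_iff restrict_def)
  have atom: "?F -` {f} \<inter> space \<mu> = {\<omega> \<in> space \<mu>. \<forall>i\<in>I. Y i \<omega> = f i}"
    "?F' -` {f} \<inter> space \<mu>' = {\<omega> \<in> space \<mu>'. \<forall>i\<in>I. Y' i \<omega> = f i}" if "f \<in> ?E" for f
    using restrict_eq[OF that] by auto
  have distr: "distr \<mu> (count_space ?E) ?F = distr \<mu>' (count_space ?E) ?F'"
  proof (rule measure_eqI_countable[OF _ _ \<open>countable ?E\<close>])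
    fix f assume f: "f \<in> ?E"
    then show "emeasure (distr \<mu> (count_space ?E) ?F) {f} = emeasure (distr \<mu>' (count_space ?E) ?F') {f}"
      using F F' by (simp add: emeasure_distr atom atoms \<mu>.emeasure_eq_measure \<mu>'.emeasure_eq_measure)
  qed auto
  let ?A = "{f \<in> ?E. Q f}"
  have local_restrict: "Q (restrict h I) \<longleftrightarrow> Q h" for h by (rule local) simp
  have pre: "?F -` ?A \<inter> space \<mu> = {\<omega> \<in> space \<mu>. Q (\<lambda>i. Y i \<omega>)}"
    using local_restrict by auto
  have pre': "?F' -` ?A \<inter> space \<mu>' = {\<omega> \<in> space \<mu>'. Q (\<lambda>i. Y' i \<omega>)}"
    using local_restrict by auto
  show "{\<omega> \<in> space \<mu>. Q (\<lambda>i. Y i \<omega>)} \<in> sets \<mu>"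
    unfolding pre[symmetric] by (rule measurable_sets[OF F]) auto
  show "measure \<mu> {\<omega> \<in> space \<mu>. Q (\<lambda>i. Y i \<omega>)} = measure \<mu>' {\<omega> \<in> space \<mu>'. Q (\<lambda>i. Y' i \<omega>)}"
    unfolding pre[symmetric] pre'[symmetric]
    using arg_cong[OF distr, of "\<lambda>D. measure D ?A"] by (simp add: measure_distr[OF F] measure_distr[OF F'])
qed

section \<open>Tail bounds for Poisson variables\<close>

lemma poisson_positive_prob:
  assumes "0 < r" shows "measure (poisson_pmf r) {0<..} = 1 - exp (- r)"
proof -
  have "{0<..} = UNIV - {0::nat}" by auto
  then have "measure (poisson_pmf r) {0<..} = 1 - measure (poisson_pmf r) {0}"
    using measure_pmf.prob_compl[of "{0}" "poisson_pmf r"] by simp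
  then show ?thesis using assms by (simp add: measure_pmf_single)
qed

lemma poisson_positive_prob_le:
  assumes "0 < r" shows "measure (poisson_pmf r) {0<..} \<le> r"
  using poisson_positive_prob[OF assms] exp_ge_add_one_self[of "- r"] by simp

text \<open>The quadratic order is what counts: \<open>n\<close> cells with parameters of order
  \<open>1 / n\<close> contribute only order \<open>1 / n\<close> in total.\<close>

lemma poisson_multiple_prob_le:
  assumes "0 < r" shows "measure (poisson_pmf r) {1<..} \<le> r\<^sup>2"
proof -
  have "{1<..} = UNIV - {0, 1::nat}" by auto
  then have "measure (poisson_pmf r) {1<..} = 1 - measure (poisson_pmf r) {0, 1}"
    using measure_pmf.prob_compl[of "{0, 1}" "poisson_pmf r"] by simp
  also have "measure (poisson_pmf r) {0, 1} = exp (- r) * (1 + r)"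
    using assms by (subst measure_measure_pmf_finite) (auto simp: algebra_simps)
  also have "1 - exp (- r) * (1 + r) \<le> 1 - (1 - r) * (1 + r)"
    using exp_ge_add_one_self[of "- r"] assms by (intro diff_left_mono mult_right_mono) auto
  also have "\<dots> = r\<^sup>2" by (simp add: algebra_simps power2_eq_square)
  finally show ?thesis .
qed

locale poisson_clock_system = prob_space \<mu> for \<mu> :: "'w measure" +
  fixes r :: "nat \<Rightarrow> real" and R :: "nat \<Rightarrow> 'w \<Rightarrow> real set"
  assumes clocks: "poisson_clocks \<mu> r R" and rate_pos: "\<And>i. 0 < r i"
begin

lemma AE_finite_rings: "AE \<omega> in \<mu>. \<forall>i b. finite (R i \<omega> \<inter> {0<..b})"
  using clocks unfolding poisson_clocks_def AE_all_countable by (auto elim!: eventually_mono)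

context
  fixes s :: "nat \<Rightarrow> real"
  assumes s: "0 \<le> s 0" "strict_mono s"
begin

lemma indep_ring_counts:
  "indep_vars (\<lambda>_. count_space UNIV) (\<lambda>ik \<omega>. ring_counts (\<lambda>i. R i \<omega>) s ik) UNIV"
proof -
  have "(\<lambda>ik \<omega>. ring_counts (\<lambda>i. R i \<omega>) s ik) = (\<lambda>(i, k) \<omega>. card (R i \<omega> \<inter> {s k<..s (Suc k)}))"
    by (auto simp: ring_counts_def fun_eq_iff)
  then show ?thesis using clocks s unfolding poisson_clocks_def by auto
qed

lemma measurable_ring_counts [measurable]:
  "(\<lambda>\<omega>. ring_counts (\<lambda>i. R i \<omega>) s ik) \<in> measurable \<mu> (count_space UNIV)"
  using indep_ring_counts unfolding indep_vars_def2 by blast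

lemma prob_ring_counts:
  "prob {\<omega> \<in> space \<mu>. ring_counts (\<lambda>i. R i \<omega>) s (i, k) \<in> A} =
    measure (poisson_pmf (r i * (s (Suc k) - s k))) A"
proof -
  have "distr \<mu> (count_space UNIV) (\<lambda>\<omega>. ring_counts (\<lambda>i. R i \<omega>) s (i, k)) =
      measure_pmf (poisson_pmf (r i * (s (Suc k) - s k)))"
    using clocks s unfolding poisson_clocks_def ring_counts_def by auto
  from arg_cong[OF this, of "\<lambda>D. measure D A"] show ?thesis
    by (simp add: measure_distr vimage_def Int_def conj_commute)
qed

lemma prob_ring_counts_Ball:
  assumes "finite I" "I \<noteq> {}"
  shows "prob {\<omega> \<in> space \<mu>. \<forall>ik\<in>I. ring_counts (\<lambda>i. R i \<omega>) s ik \<in> A ik} =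
    (\<Prod>(i, k)\<in>I. measure (poisson_pmf (r i * (s (Suc k) - s k))) (A (i, k)))"
proof -
  have "prob (\<Inter>ik\<in>I. (\<lambda>\<omega>. ring_counts (\<lambda>i. R i \<omega>) s ik) -` A ik \<inter> space \<mu>) =
      (\<Prod>ik\<in>I. prob ((\<lambda>\<omega>. ring_counts (\<lambda>i. R i \<omega>) s ik) -` A ik \<inter> space \<mu>))"
    using assms by (intro indep_varsD[OF indep_ring_counts]) auto
  also have "(\<Inter>ik\<in>I. (\<lambda>\<omega>. ring_counts (\<lambda>i. R i \<omega>) s ik) -` A ik \<inter> space \<mu>) =
      {\<omega> \<in> space \<mu>. \<forall>ik\<in>I. ring_counts (\<lambda>i. R i \<omega>) s ik \<in> A ik}"
    using assms by auto
  also have "(\<lambda>ik. prob ((\<lambda>\<omega>. ring_counts (\<lambda>i. R i \<omega>) s ik) -` A ik \<inter> space \<mu>)) =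
      (\<lambda>(i, k). measure (poisson_pmf (r i * (s (Suc k) - s k))) (A (i, k)))"
    by (auto simp: fun_eq_iff prob_ring_counts[symmetric] vimage_def Int_def conj_commute)
  finally show ?thesis .
qed

text \<open>Two rings in a cell come from one clock ringing twice or from two independent clocks
  ringing once each. Either has probability at most \<open>a\<^sup>2\<close>, and there are
  \<open>(L + 1)\<^sup>2\<close> pairs of clocks.\<close>

lemma prob_ring_counts_collision:
  assumes a: "\<And>i. r i * (s (Suc k) - s k) \<le> a"
  shows "prob {\<omega> \<in> space \<mu>. 1 < (\<Sum>i\<le>L. ring_counts (\<lambda>i. R i \<omega>) s (i, k))} \<le> (real (L + 1))\<^sup>2 * a\<^sup>2"
proof -
  let ?c = "\<lambda>\<omega>. ring_counts (\<lambda>i. R i \<omega>) s"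
  let ?E = "\<lambda>(i, j). if i = j then {\<omega> \<in> space \<mu>. ?c \<omega> (i, k) \<in> {1<..}}
    else {\<omega> \<in> space \<mu>. \<forall>ik\<in>{(i, k), (j, k)}. ?c \<omega> ik \<in> {0<..}}"
  have h: "0 < r i * (s (Suc k) - s k)" for i
    using rate_pos s strict_monoD[of s k "Suc k"] by simp
  have bound: "prob (?E (i, j)) \<le> a\<^sup>2" for i j
  proof (cases "i = j")
    case True
    have "prob (?E (i, j)) \<le> (r i * (s (Suc k) - s k))\<^sup>2"
      using poisson_multiple_prob_le[OF h, of i] unfolding True
      by (simp only: prob_ring_counts simp_thms if_True case_prod_conv)
    also have "\<dots> \<le> a\<^sup>2" using a[of i] h[of i] by (intro power_mono) auto
    finally show ?thesis .
  next
    case False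
    have le: "measure (poisson_pmf (r i * (s (Suc k) - s k))) {0<..} \<le> a" for i
      using poisson_positive_prob_le[OF h] a order_trans by blast
    have "prob (?E (i, j)) = measure (poisson_pmf (r i * (s (Suc k) - s k))) {0<..}
        * measure (poisson_pmf (r j * (s (Suc k) - s k))) {0<..}"
      using False by (simp only: case_prod_conv if_False, subst prob_ring_counts_Ball) auto
    also have "\<dots> \<le> a * a"
      using le order_trans[OF measure_nonneg le] by (intro mult_mono) auto
    finally show ?thesis by (simp add: power2_eq_square)
  qed
  have "{\<omega> \<in> space \<mu>. 1 < (\<Sum>i\<le>L. ?c \<omega> (i, k))} \<subseteq> (\<Union>ij\<in>{..L} \<times> {..L}. ?E ij)"
  proof safe
    fix \<omega> assume \<omega>: "\<omega> \<in> space \<mu>" "1 < (\<Sum>i\<le>L. ?c \<omega> (i, k))"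
    then have "(\<Sum>i\<le>L. ?c \<omega> (i, k)) \<noteq> 0" by linarith
    then obtain i where i: "i \<le> L" "?c \<omega> (i, k) \<noteq> 0" by (meson atMost_iff sum.neutral)
    show "\<omega> \<in> (\<Union>ij\<in>{..L} \<times> {..L}. ?E ij)"
    proof (cases "?c \<omega> (i, k) > 1")
      case True
      then show ?thesis using \<omega> i by (intro UN_I[of "(i, i)"]) auto
    next
      case False
      have "1 < ?c \<omega> (i, k) + (\<Sum>j\<in>{..L} - {i}. ?c \<omega> (j, k))"
        using \<omega>(2) i(1) by (subst (asm) sum.remove[of _ i]) auto
      with False have "(\<Sum>j\<in>{..L} - {i}. ?c \<omega> (j, k)) \<noteq> 0" by linarith
      then obtain j where "j \<in> {..L} - {i}" "?c \<omega> (j, k) \<noteq> 0"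
        by (meson sum.neutral)
      then show ?thesis using \<omega> i by (intro UN_I[of "(i, j)"]) auto
    qed
  qed
  then have "prob {\<omega> \<in> space \<mu>. 1 < (\<Sum>i\<le>L. ?c \<omega> (i, k))} \<le> prob (\<Union>ij\<in>{..L} \<times> {..L}. ?E ij)"
    by (intro finite_measure_mono sets.finite_UN) (auto intro!: sets.sets_Collect_finite_All)
  also have "\<dots> \<le> (\<Sum>ij\<in>{..L} \<times> {..L}. prob (?E ij))"
    by (intro finite_measure_subadditive_finite) auto
  also have "\<dots> \<le> (\<Sum>ij\<in>{..L} \<times> {..L}. a\<^sup>2)"
    using bound by (intro sum_mono) (auto split: prod.split)
  also have "\<dots> = (real (L + 1))\<^sup>2 * a\<^sup>2" by (simp add: power2_eq_square algebra_simps)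
  finally show ?thesis .
qed

end

end

section \<open>Count arrays on an equidistant time grid\<close>

context poisson_clock_system
begin

context
  fixes T :: real and n :: nat and s :: "nat \<Rightarrow> real"
  assumes T: "T > 0" and n: "n > 0"
  defines "s \<equiv> \<lambda>k. T * real k / real n"
begin

lemma cell_grid: "0 \<le> s 0" "strict_mono s" "s (Suc k) - s k = T / n"
  using T n by (auto simp: s_def strict_mono_def divide_strict_right_mono field_simps)

lemmas grid_counts [measurable] = measurable_ring_counts[OF cell_grid(1,2)]

lemma prob_count_array:
  "prob {\<omega> \<in> space \<mu>. \<forall>ik\<in>{..L} \<times> {..<n}. ring_counts (\<lambda>i. R i \<omega>) s ik = f ik} =
    (\<Prod>i\<le>L. \<Prod>k<n. pmf (poisson_pmf (r i * (T / n))) (f (i, k)))"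
  using prob_ring_counts_Ball[OF cell_grid(1,2), of "{..L} \<times> {..<n}" "\<lambda>ik. {f ik}"] n
  by (simp add: cell_grid measure_pmf_single prod.cartesian_product split_def lessThan_empty_iff)

text \<open>All cells have the same length, so the product of Poisson weights is unchanged when the
  cells are reflected.\<close>

lemma prob_rev_count_array:
  "prob {\<omega> \<in> space \<mu>. \<forall>ik\<in>{..L} \<times> {..<n}. rev_cells n (ring_counts (\<lambda>i. R i \<omega>) s) ik = f ik} =
    (\<Prod>i\<le>L. \<Prod>k<n. pmf (poisson_pmf (r i * (T / n))) (f (i, k)))"
proof -
  have rev_eq: "\<forall>ik\<in>{..L} \<times> {..<n}. c' ik = rev_cells n c ik"
    if *: "\<forall>ik\<in>{..L} \<times> {..<n}. rev_cells n c' ik = c ik" for c c' :: "nat \<times> nat \<Rightarrow> nat"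
  proof clarsimp
    fix i k assume "i \<le> L" "k < n"
    then show "c' (i, k) = rev_cells n c (i, k)"
      using bspec[OF *, of "(i, n - Suc k)"] by (simp add: rev_cells_def)
  qed
  have "(\<forall>ik\<in>{..L} \<times> {..<n}. rev_cells n c ik = f ik) \<longleftrightarrow>
      (\<forall>ik\<in>{..L} \<times> {..<n}. c ik = rev_cells n f ik)" for c :: "nat \<times> nat \<Rightarrow> nat"
    using rev_eq[of c f] rev_eq[of f c] by metis
  moreover have "(\<Prod>k<n. pmf (poisson_pmf (r i * (T / n))) (rev_cells n f (i, k))) =
      (\<Prod>k<n. pmf (poisson_pmf (r i * (T / n))) (f (i, k)))" for i
    using prod.nat_diff_reindex[of "\<lambda>k. pmf (poisson_pmf (r i * (T / n))) (f (i, k))" n]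
    by (simp add: rev_cells_def)
  ultimately show ?thesis using prob_count_array[of L "rev_cells n f"] by simp
qed

text \<open>Bonds beyond \<open>K\<close> ring independently at rate 1, each during
  \<open>(0, T]\<close> with probability \<open>1 - exp (- T)\<close>.\<close>

lemma prob_all_bonds_ring_le:
  assumes one: "\<And>j. K < j \<Longrightarrow> r j = 1" and "K \<le> L"
  shows "prob {\<omega> \<in> space \<mu>. \<forall>j\<in>{K<..L}. \<exists>k<n. ring_counts (\<lambda>i. R i \<omega>) s (j, k) \<noteq> 0} \<le>
    (1 - exp (- T)) ^ (L - K)"
proof -
  \<comment> \<open>On this coarser grid the cell 0 is the whole of \<open>(0, T]\<close>, so one
    count per bond suffices.\<close>
  define u where "u = (\<lambda>k. T * real k)"
  have u: "0 \<le> u 0" "strict_mono u" using T by (auto simp: u_def strict_mono_def)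
  note [measurable] = measurable_ring_counts[OF u]
  have u_count: "ring_counts (\<lambda>i. R i \<omega>) u (j, 0) = card (R j \<omega> \<inter> {0<..T})" for \<omega> j
    by (simp add: ring_counts_def u_def)
  have sub: "0 < card (R j \<omega> \<inter> {0<..T})"
    if "\<forall>i b. finite (R i \<omega> \<inter> {0<..b})" "k < n" "ring_counts (\<lambda>i. R i \<omega>) s (j, k) \<noteq> 0" for \<omega> j k
  proof -
    have "T * real (Suc k) \<le> T * real n" using that(2) T by (intro mult_left_mono) auto
    then have "s (Suc k) \<le> T" using n by (simp add: s_def pos_divide_le_eq)
    moreover have "0 \<le> s k" using T by (simp add: s_def)
    ultimately have "R j \<omega> \<inter> {s k<..s (Suc k)} \<subseteq> R j \<omega> \<inter> {0<..T}" by auto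
    moreover have "finite (R j \<omega> \<inter> {0<..T})" using that(1) by blast
    ultimately show ?thesis
      using card_mono that(3) unfolding ring_counts_def case_prod_conv by (metis le_zero_eq not_gr_zero)
  qed
  have "prob {\<omega> \<in> space \<mu>. \<forall>j\<in>{K<..L}. \<exists>k<n. ring_counts (\<lambda>i. R i \<omega>) s (j, k) \<noteq> 0} \<le>
      prob {\<omega> \<in> space \<mu>. \<forall>jk\<in>{K<..L} \<times> {0}. ring_counts (\<lambda>i. R i \<omega>) u jk \<in> {0<..}}"
  \<comment> \<open>The inclusion holds only almost surely: an infinite set of rings would be
    counted as 0 on the coarse grid.\<close>
  proof (rule finite_measure_mono_AE)
    show "AE \<omega> in \<mu>. \<omega> \<in> {\<omega> \<in> space \<mu>. \<forall>j\<in>{K<..L}. \<exists>k<n. ring_counts (\<lambda>i. R i \<omega>) s (j, k) \<noteq> 0} \<longrightarrow>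
        \<omega> \<in> {\<omega> \<in> space \<mu>. \<forall>jk\<in>{K<..L} \<times> {0}. ring_counts (\<lambda>i. R i \<omega>) u jk \<in> {0<..}}"
      using AE_finite_rings
    proof eventually_elim
      case (elim \<omega>)
      then show ?case
        using sub[OF elim] by (auto simp: u_count)
    qed
  qed (auto intro!: sets.sets_Collect_finite_All)
  also have "\<dots> = (1 - exp (- T)) ^ (L - K)"
  proof (cases "K = L")
    case False
    have "measure (poisson_pmf (r j * T)) {0<..} = 1 - exp (- T)" if "j \<in> {K<..L}" for j
      using poisson_positive_prob[OF T] one[of j] that by simp
    then show ?thesis
      using False \<open>K \<le> L\<close> prob_ring_counts_Ball[OF u, of "{K<..L} \<times> {0}" "\<lambda>_. {0<..}"]
      by (simp add: prod.cartesian_product[symmetric] u_def)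
  qed (simp add: prob_space)
  finally show ?thesis .
qed

lemma decodable_measurable [measurable]:
  "{\<omega> \<in> space \<mu>. decodable K L n (ring_counts (\<lambda>i. R i \<omega>) s)} \<in> sets \<mu>"
  unfolding decodable_def by measurable

text \<open>Union bound: either every bond in \<open>{K<..L}\<close> rings, or one of
  \<open>n\<close> cells of length \<open>T / n\<close> has a collision.\<close>

lemma prob_not_decodable_le:
  assumes one: "\<And>j. K < j \<Longrightarrow> r j = 1" and "K \<le> L" and a: "\<And>i. r i \<le> a"
  shows "prob {\<omega> \<in> space \<mu>. \<not> decodable K L n (ring_counts (\<lambda>i. R i \<omega>) s)} \<le>
    (1 - exp (- T)) ^ (L - K) + (real (L + 1) * (a * T))\<^sup>2 / n"
proof -
  let ?c = "\<lambda>\<omega>. ring_counts (\<lambda>i. R i \<omega>) s"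
  let ?E = "\<lambda>k. {\<omega> \<in> space \<mu>. 1 < (\<Sum>i\<le>L. ?c \<omega> (i, k))}"
  let ?S = "{\<omega> \<in> space \<mu>. \<forall>j\<in>{K<..L}. \<exists>k<n. ?c \<omega> (j, k) \<noteq> 0}"
  have "prob {\<omega> \<in> space \<mu>. \<not> decodable K L n (?c \<omega>)} \<le> prob (?S \<union> (\<Union>k<n. ?E k))"
    by (intro finite_measure_mono) (auto simp: decodable_def)
  also have "\<dots> \<le> prob ?S + prob (\<Union>k<n. ?E k)"
    by (intro measure_Un_le) auto
  also have "prob (\<Union>k<n. ?E k) \<le> (\<Sum>k<n. prob (?E k))"
    by (intro finite_measure_subadditive_finite) auto
  also have "\<dots> \<le> (\<Sum>k<n. (real (L + 1))\<^sup>2 * (a * (T / n))\<^sup>2)"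
    using a T by (intro sum_mono prob_ring_counts_collision cell_grid) (simp add: cell_grid mult_right_mono divide_right_mono)
  also have "\<dots> = (real (L + 1) * (a * T))\<^sup>2 / n"
    using n by (simp add: power2_eq_square field_simps)
  finally show ?thesis using prob_all_bonds_ring_le[OF one \<open>K \<le> L\<close>] by simp
qed

end

end

section \<open>Reversal of the driving word\<close>

lemma half_line_open_tasepE:
  assumes "half_line_open_tasep \<mu> \<alpha> \<eta>0 X" "\<alpha> > 0"
  obtains R where "poisson_clock_system \<mu> (clock_rate \<alpha>) R"
    "AE \<omega> in \<mu>. driven_path (\<lambda>i. R i \<omega>) \<eta>0 (\<lambda>t. X t \<omega>)"
proof -
  obtain R where R: "prob_space \<mu>" "poisson_clocks \<mu> (clock_rate \<alpha>) R"
    "AE \<omega> in \<mu>. driven_path (\<lambda>i. R i \<omega>) \<eta>0 (\<lambda>t. X t \<omega>)"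
    using assms(1) unfolding half_line_open_tasep_def by blast
  interpret prob_space \<mu> by fact
  have "poisson_clock_system \<mu> (clock_rate \<alpha>) R"
    using R(2) assms(2) by unfold_locales (auto simp: clock_rate_def)
  then show thesis using R(3) by (rule that)
qed

text \<open>On the decodable event the configuration at time \<open>T\<close> is almost surely the
  image of the word read off the counts. So the two events differ, up to a null set, only where
  decoding fails.\<close>

lemma (in poisson_clock_system) prob_ring_word_approx:
  fixes T :: real and n :: nat
  defines "c \<equiv> \<lambda>\<omega>. ring_counts (\<lambda>i. R i \<omega>) (\<lambda>k. T * real k / real n)"
  assumes T: "T > 0" and n: "n > 0"
    and path: "AE \<omega> in \<mu>. driven_path (\<lambda>i. R i \<omega>) \<eta>0 (\<lambda>t. X t \<omega>)"
    and init: "\<And>y. y > K \<Longrightarrow> \<eta>0 y = \<infinity>"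
    and event: "{\<omega> \<in> space \<mu>. P (X T \<omega>)} \<in> sets \<mu>"
    and one: "\<And>j. K < j \<Longrightarrow> r j = 1" and "K \<le> L" and a: "\<And>i. r i \<le> a"
    and Q: "Q = (\<lambda>c. decodable K L n c \<and> P (fold ring_update (ring_word L n c) \<eta>0))"
    and Q_event: "{\<omega> \<in> space \<mu>. Q (c \<omega>)} \<in> sets \<mu>"
  shows "\<bar>prob {\<omega> \<in> space \<mu>. P (X T \<omega>)} - prob {\<omega> \<in> space \<mu>. Q (c \<omega>)}\<bar> \<le>
    (1 - exp (- T)) ^ (L - K) + (real (L + 1) * (a * T))\<^sup>2 / n"
proof -
  have not_dec: "{\<omega> \<in> space \<mu>. \<not> decodable K L n (c \<omega>)} \<in> events"
    unfolding c_def by (intro sets.sets_Collect_neg decodable_measurable T n)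
  have AE: "AE \<omega> in \<mu>. decodable K L n (c \<omega>) \<longrightarrow> X T \<omega> = fold ring_update (ring_word L n (c \<omega>)) \<eta>0"
    using path AE_finite_rings
  proof eventually_elim
    case (elim \<omega>)
    then show ?case
      unfolding c_def by (intro impI driven_path_ring_word[OF elim(1) init T n]) auto
  qed
  have "prob {\<omega> \<in> space \<mu>. Q (c \<omega>)} \<le> prob {\<omega> \<in> space \<mu>. P (X T \<omega>)}"
    using AE event by (intro finite_measure_mono_AE) (auto simp: Q elim!: eventually_mono)
  moreover have "prob {\<omega> \<in> space \<mu>. P (X T \<omega>)} \<le>
      prob ({\<omega> \<in> space \<mu>. Q (c \<omega>)} \<union> {\<omega> \<in> space \<mu>. \<not> decodable K L n (c \<omega>)})"
    using AE by (intro finite_measure_mono_AE sets.Un[OF Q_event not_dec]) (auto simp: Q elim!: eventually_mono)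
  moreover have "\<dots> \<le> prob {\<omega> \<in> space \<mu>. Q (c \<omega>)} + prob {\<omega> \<in> space \<mu>. \<not> decodable K L n (c \<omega>)}"
    using Q_event not_dec by (rule measure_Un_le)
  moreover have "prob {\<omega> \<in> space \<mu>. \<not> decodable K L n (c \<omega>)} \<le>
      (1 - exp (- T)) ^ (L - K) + (real (L + 1) * (a * T))\<^sup>2 / n"
    unfolding c_def by (rule prob_not_decodable_le[OF T n one \<open>K \<le> L\<close> a])
  ultimately show ?thesis by linarith
qed

text \<open>This transfers an identity between a word and its reverse, valid for each fixed word, to
  probabilities. Both events are approximated by events about count arrays that correspond under
  reversal of the cells, which preserves the law of the array.\<close>

lemma tasep_word_reversal:
  assumes X: "half_line_open_tasep \<mu> \<alpha> \<eta>0 X" and X': "half_line_open_tasep \<mu>' \<alpha> \<eta>0' X'"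
    and "\<alpha> > 0" "T \<ge> 0"
    and init: "\<And>y. y > K \<Longrightarrow> \<eta>0 y = \<infinity>" and init': "\<And>y. y > K \<Longrightarrow> \<eta>0' y = \<infinity>"
    and reversal: "\<And>w. P (fold ring_update w \<eta>0) \<longleftrightarrow> P' (fold ring_update (rev w) \<eta>0')"
    and event: "{\<omega> \<in> space \<mu>. P (X T \<omega>)} \<in> sets \<mu>"
    and event': "{\<omega> \<in> space \<mu>'. P' (X' T \<omega>)} \<in> sets \<mu>'"
  shows "measure \<mu> {\<omega> \<in> space \<mu>. P (X T \<omega>)} = measure \<mu>' {\<omega> \<in> space \<mu>'. P' (X' T \<omega>)}"
proof -
  obtain R where R: "poisson_clock_system \<mu> (clock_rate \<alpha>) R"
    and path: "AE \<omega> in \<mu>. driven_path (\<lambda>i. R i \<omega>) \<eta>0 (\<lambda>t. X t \<omega>)"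
    using half_line_open_tasepE[OF X \<open>\<alpha> > 0\<close>] by blast
  obtain R' where R': "poisson_clock_system \<mu>' (clock_rate \<alpha>) R'"
    and path': "AE \<omega> in \<mu>'. driven_path (\<lambda>i. R' i \<omega>) \<eta>0' (\<lambda>t. X' t \<omega>)"
    using half_line_open_tasepE[OF X' \<open>\<alpha> > 0\<close>] by blast
  interpret \<mu>: poisson_clock_system \<mu> "clock_rate \<alpha>" R by fact
  interpret \<mu>': poisson_clock_system \<mu>' "clock_rate \<alpha>" R' by fact
  show ?thesis
  proof (cases "T = 0")
    \<comment> \<open>At time 0 no grid exists; both processes are almost surely at their initial
      states, and the identity is used for the empty word.\<close>
    case True
    have "AE \<omega> in \<mu>. X T \<omega> = \<eta>0" "AE \<omega> in \<mu>'. X' T \<omega> = \<eta>0'"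
      using path path' True by (auto simp: driven_path_def elim!: eventually_mono)
    then have "AE \<omega> in \<mu>. P (X T \<omega>) \<longleftrightarrow> P \<eta>0" "AE \<omega> in \<mu>'. P' (X' T \<omega>) \<longleftrightarrow> P' \<eta>0'"
      by (auto elim!: eventually_mono)
    then have "measure \<mu> {\<omega> \<in> space \<mu>. P (X T \<omega>)} = measure \<mu> {\<omega> \<in> space \<mu>. P \<eta>0}"
      "measure \<mu>' {\<omega> \<in> space \<mu>'. P' (X' T \<omega>)} = measure \<mu>' {\<omega> \<in> space \<mu>'. P' \<eta>0'}"
      using event event' by (auto intro!: \<mu>.finite_measure_eq_AE \<mu>'.finite_measure_eq_AE)
    then show ?thesis
      using reversal[of "[]"] by (cases "P' \<eta>0'") (simp_all add: \<mu>.prob_space \<mu>'.prob_space)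
  next
    case False
    then have T: "T > 0" using \<open>T \<ge> 0\<close> by simp
    let ?p = "measure \<mu> {\<omega> \<in> space \<mu>. P (X T \<omega>)}" and ?p' = "measure \<mu>' {\<omega> \<in> space \<mu>'. P' (X' T \<omega>)}"
    define a where "a = max \<alpha> 1"
    have a: "clock_rate \<alpha> i \<le> a" and one: "K < j \<Longrightarrow> clock_rate \<alpha> j = 1" for i j
      by (simp_all add: clock_rate_def a_def)
    have bound: "\<bar>?p - ?p'\<bar> \<le> 2 * ((1 - exp (- T)) ^ (L - K) + (real (L + 1) * (a * T))\<^sup>2 / n)"
      if "K \<le> L" "n > 0" for L n :: nat
    proof -
      define c where "c = (\<lambda>\<omega>. ring_counts (\<lambda>i. R i \<omega>) (\<lambda>k. T * real k / real n))"
      define c' where "c' = (\<lambda>\<omega>. ring_counts (\<lambda>i. R' i \<omega>) (\<lambda>k. T * real k / real n))"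
      define Q where "Q = (\<lambda>c. decodable K L n c \<and> P (fold ring_update (ring_word L n c) \<eta>0))"
      define Q' where "Q' = (\<lambda>c. decodable K L n c \<and> P' (fold ring_update (ring_word L n c) \<eta>0'))"
      have local: "Q f \<longleftrightarrow> Q g" "Q' f \<longleftrightarrow> Q' g" if "\<And>i. i \<in> {..L} \<times> {..<n} \<Longrightarrow> f i = g i" for f g
      proof -
        have "f (i, k) = g (i, k)" if "i \<le> L" "k < n" for i k
          using \<open>\<And>i. i \<in> {..L} \<times> {..<n} \<Longrightarrow> f i = g i\<close> that by simp
        note * = ring_word_cong[of L n f g, OF this] decodable_cong[of L n f g, OF this]
        show "Q f \<longleftrightarrow> Q g" "Q' f \<longleftrightarrow> Q' g" unfolding Q_def Q'_def using * by auto
      qed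
      \<comment> \<open>Here the reversal identity for words meets the reversal of cells.\<close>
      have Q_rev: "Q (rev_cells n f) \<longleftrightarrow> Q' f" for f
        unfolding Q_def Q'_def decodable_rev_cells reversal
        using ring_word_rev_cells[of K L n f] by auto
      have c_meas: "(\<lambda>\<omega>. c \<omega> ik) \<in> measurable \<mu> (count_space UNIV)"
        and c'_meas: "(\<lambda>\<omega>. c' \<omega> ik) \<in> measurable \<mu>' (count_space UNIV)" for ik
        unfolding c_def c'_def by (intro \<mu>.grid_counts \<mu>'.grid_counts T \<open>n > 0\<close>)+
      have rev_meas: "(\<lambda>\<omega>. rev_cells n (c' \<omega>) ik) \<in> measurable \<mu>' (count_space UNIV)" for ik
        using c'_meas by (simp add: rev_cells_def split_def)
      have atoms: "measure \<mu> {\<omega> \<in> space \<mu>. \<forall>ik\<in>{..L} \<times> {..<n}. c \<omega> ik = f ik} =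
          measure \<mu>' {\<omega> \<in> space \<mu>'. \<forall>ik\<in>{..L} \<times> {..<n}. rev_cells n (c' \<omega>) ik = f ik}" for f
        unfolding c_def c'_def
        by (simp only: \<mu>.prob_count_array[OF T \<open>n > 0\<close>] \<mu>'.prob_rev_count_array[OF T \<open>n > 0\<close>])
      have fin: "finite ({..L} \<times> {..<n})" by simp
      note law = joint_law_eqI[OF fin c_meas rev_meas \<mu>.prob_space_axioms \<mu>'.prob_space_axioms atoms]
      have event_Q: "{\<omega> \<in> space \<mu>. Q (c \<omega>)} \<in> sets \<mu>"
        by (rule law(1)) (rule local(1))
      have "measure \<mu> {\<omega> \<in> space \<mu>. Q (c \<omega>)} = measure \<mu>' {\<omega> \<in> space \<mu>'. Q (rev_cells n (c' \<omega>))}"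
        by (rule law(2)) (rule local(1))
      then have same_law: "measure \<mu> {\<omega> \<in> space \<mu>. Q (c \<omega>)} = measure \<mu>' {\<omega> \<in> space \<mu>'. Q' (c' \<omega>)}"
        unfolding Q_rev .
      have event_Q': "{\<omega> \<in> space \<mu>'. Q' (c' \<omega>)} \<in> sets \<mu>'"
        by (rule joint_law_eqI(1)[OF fin c'_meas c'_meas \<mu>'.prob_space_axioms \<mu>'.prob_space_axioms refl])
          (rule local(2))
      have "\<bar>?p - measure \<mu> {\<omega> \<in> space \<mu>. Q (c \<omega>)}\<bar> \<le>
          (1 - exp (- T)) ^ (L - K) + (real (L + 1) * (a * T))\<^sup>2 / n"
        unfolding c_def
        by (intro \<mu>.prob_ring_word_approx[OF T \<open>n > 0\<close> path init event one \<open>K \<le> L\<close> a Q_def])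
          (use event_Q in \<open>simp_all add: c_def\<close>)
      moreover have "\<bar>?p' - measure \<mu>' {\<omega> \<in> space \<mu>'. Q' (c' \<omega>)}\<bar> \<le>
          (1 - exp (- T)) ^ (L - K) + (real (L + 1) * (a * T))\<^sup>2 / n"
        unfolding c'_def
        by (intro \<mu>'.prob_ring_word_approx[OF T \<open>n > 0\<close> path' init' event' one \<open>K \<le> L\<close> a Q'_def])
          (use event_Q' in \<open>simp_all add: c'_def\<close>)
      moreover have "\<bar>x - y\<bar> \<le> 2 * d" if "\<bar>x - q\<bar> \<le> d" "\<bar>y - q\<bar> \<le> d" for x y q d :: real
        using that by linarith
      ultimately show ?thesis unfolding same_law by blast
    qed
    \<comment> \<open>The collision term grows with \<open>L\<close>, so \<open>n\<close> tends to
      infinity first with \<open>L = K + m\<close> fixed, and only then \<open>m\<close>.\<close>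
    have bound_L: "\<bar>?p - ?p'\<bar> \<le> 2 * (1 - exp (- T)) ^ m" for m
    proof (rule LIMSEQ_le_const)
      show "(\<lambda>n. 2 * ((1 - exp (- T)) ^ m + (real (K + m + 1) * (a * T))\<^sup>2 / real n))
          \<longlonglongrightarrow> 2 * (1 - exp (- T)) ^ m"
        by (rule tendsto_eq_intros lim_const_over_n refl | simp)+
      show "\<exists>n0. \<forall>n\<ge>n0. \<bar>?p - ?p'\<bar> \<le> 2 * ((1 - exp (- T)) ^ m + (real (K + m + 1) * (a * T))\<^sup>2 / real n)"
        using bound[of "K + m"] by (intro exI[of _ 1]) (auto simp: Suc_le_eq)
    qed
    have "\<bar>?p - ?p'\<bar> \<le> 0"
    proof (rule LIMSEQ_le_const)
      have "(\<lambda>m. (1 - exp (- T)) ^ m) \<longlonglongrightarrow> 0" using T by (intro LIMSEQ_realpow_zero) auto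
      from tendsto_mult_right_zero[OF this, of 2] show "(\<lambda>m. 2 * (1 - exp (- T)) ^ m) \<longlonglongrightarrow> 0" .
    qed (use bound_L in blast)
    then show ?thesis by simp
  qed
qed

section \<open>Measurability of the observables\<close>

lemma measurable_countable_combine:
  fixes f g k :: "'a \<Rightarrow> 'i :: countable"
  assumes "f \<in> measurable M (count_space UNIV)" "g \<in> measurable M (count_space UNIV)"
    "k \<in> measurable M (count_space UNIV)"
  shows "(\<lambda>\<omega>. h (f \<omega>) (g \<omega>) (k \<omega>)) \<in> measurable M (count_space UNIV)"
  by (rule measurable_compose_countable[OF _ assms(1)], rule measurable_compose_countable[OF _ assms(2)],
      rule measurable_compose_countable[OF _ assms(3)]) simp

lemma num_ge_measurable:
  assumes "\<And>x. (\<lambda>\<omega>. X \<omega> x) \<in> measurable \<mu> (count_space UNIV)"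
  shows "(\<lambda>\<omega>. num_ge c x (X \<omega>)) \<in> measurable \<mu> (count_space UNIV)"
proof -
  note [measurable] = assms
  have "(\<lambda>\<omega>. card {y. x \<le> y \<and> X \<omega> y = c}) \<in> measurable \<mu> (count_space UNIV)"
    by measurable
  then show ?thesis unfolding num_ge_def by measurable
qed

lemma second_class_pos_measurable:
  assumes "\<And>x. (\<lambda>\<omega>. X \<omega> x) \<in> measurable \<mu> (count_space UNIV)"
  shows "{\<omega> \<in> space \<mu>. second_class_pos (X \<omega>) < 0} \<in> sets \<mu>"
proof -
  note [measurable] = assms
  have "second_class_pos \<eta> < 0 \<longleftrightarrow> (\<forall>x. 1 \<le> x \<longrightarrow> \<eta> x \<noteq> 2)" for \<eta>
    by (auto simp: second_class_pos_def)
  then show ?thesis by simp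
qed

theorem theorem3p9:
  fixes M N :: nat and \<alpha> t :: real
    and \<mu>1 :: "'a measure" and \<xi> :: "real \<Rightarrow> 'a \<Rightarrow> config"
    and \<mu>2 :: "'b measure" and \<xi>' :: "real \<Rightarrow> 'b \<Rightarrow> config"
    and \<mu>3 :: "'c measure" and \<zeta> :: "real \<Rightarrow> 'c \<Rightarrow> config"
    and g :: "'a \<Rightarrow> int" and NN :: "enat \<Rightarrow> 'b \<Rightarrow> int" and S :: "nat \<Rightarrow> 'c \<Rightarrow> int"
    and X1 X2 X3 :: "'c \<Rightarrow> int"
  assumes "M > 0" and "N > 0" and "\<alpha> > 0" and "t \<ge> 0"
    and "half_line_open_tasep \<mu>1 \<alpha> (xi_init M N) \<xi>"
    and "half_line_open_tasep \<mu>2 \<alpha> (xi_tilde_init M N) \<xi>'"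
    and "half_line_open_tasep \<mu>3 \<alpha> empty_init \<zeta>"
  defines "g \<equiv> \<lambda>\<omega>. second_class_pos (\<xi> t \<omega>)"
    and "NN \<equiv> \<lambda>c \<omega>. num_ge c 1 (\<xi>' t \<omega>)"
    and "S \<equiv> \<lambda>x \<omega>. num_ge 1 x (\<zeta> t \<omega>)"
  defines "X1 \<equiv> \<lambda>\<omega>. S 1 \<omega>"
    and "X2 \<equiv> \<lambda>\<omega>. min (int M) (int M + int N - S 1 \<omega> + S (M + N + 1) \<omega>)"
    and "X3 \<equiv> \<lambda>\<omega>. min (int N + 1)
           (int M + int N + 1 - S (M + N + 1) \<omega> + S (2 * M + 2 * N + 2) \<omega>
              + max 0 (int N - S 1 \<omega> + S (M + N + 1) \<omega>))"
  shows "measure \<mu>1 {\<omega> \<in> space \<mu>1. g \<omega> < 0} =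
           measure \<mu>3 {\<omega> \<in> space \<mu>3.
             S (N + M + 1) \<omega> - S (2 * N + 2 * M + 2) \<omega>
               + min (int N) (S 1 \<omega> - S (N + M + 1) \<omega>) \<ge> int N + int M + 1}
       \<and> distr \<mu>2 (count_space UNIV) (\<lambda>\<omega>. (NN 1 \<omega>, NN 2 \<omega>, NN 3 \<omega>)) =
           distr \<mu>3 (count_space UNIV) (\<lambda>\<omega>. (X1 \<omega>, X2 \<omega>, X3 \<omega>))"
proof
  have site [measurable]: "(\<lambda>\<omega>. \<xi> t \<omega> x) \<in> measurable \<mu>1 (count_space UNIV)"
    "(\<lambda>\<omega>. \<xi>' t \<omega> x) \<in> measurable \<mu>2 (count_space UNIV)"
    "(\<lambda>\<omega>. \<zeta> t \<omega> x) \<in> measurable \<mu>3 (count_space UNIV)" for x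
    using assms(4-7) by (auto simp: half_line_open_tasep_def)
  have NN_meas: "NN c \<in> measurable \<mu>2 (count_space UNIV)"
    and S_meas: "S x \<in> measurable \<mu>3 (count_space UNIV)" for c x
    unfolding NN_def S_def by (intro num_ge_measurable site)+
  note S_combine = measurable_countable_combine[OF S_meas S_meas S_meas]
  interpret \<mu>2: prob_space \<mu>2 using assms(6) by (simp add: half_line_open_tasep_def)
  interpret \<mu>3: prob_space \<mu>3 using assms(7) by (simp add: half_line_open_tasep_def)
  \<comment> \<open>This is the last occupied site of both shock initial conditions.\<close>
  let ?K = "2 * N + 2 * M + 1"
  have init: "?K < y \<Longrightarrow> xi_init M N y = \<infinity>" "?K < y \<Longrightarrow> xi_tilde_init M N y = \<infinity>"
    "?K < y \<Longrightarrow> empty_init y = \<infinity>" for y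
    by (simp_all add: xi_init_def xi_tilde_init_def empty_init_def)
  let ?P = "\<lambda>\<eta>. num_ge 1 (N + M + 1) \<eta> - num_ge 1 (2 * N + 2 * M + 2) \<eta>
    + min (int N) (num_ge 1 1 \<eta> - num_ge 1 (N + M + 1) \<eta>) \<ge> int N + int M + 1"
  have event: "{\<omega> \<in> space \<mu>3. ?P (\<zeta> t \<omega>)} \<in> sets \<mu>3"
    using measurable_sets[OF S_combine, of "{True}"
        "\<lambda>a b c. b - c + min (int N) (a - b) \<ge> int N + int M + 1" 1 "N + M + 1" "2 * N + 2 * M + 2"]
    by (simp add: S_def vimage_def Int_def conj_commute)
  show "measure \<mu>1 {\<omega> \<in> space \<mu>1. g \<omega> < 0} =
      measure \<mu>3 {\<omega> \<in> space \<mu>3. S (N + M + 1) \<omega> - S (2 * N + 2 * M + 2) \<omega>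
        + min (int N) (S 1 \<omega> - S (N + M + 1) \<omega>) \<ge> int N + int M + 1}"
    unfolding g_def S_def
  proof (rule tasep_word_reversal[OF assms(5,7,3,4), where K = ?K and P = "\<lambda>\<eta>. second_class_pos \<eta> < 0" and P' = ?P])
    show "second_class_pos (fold ring_update w (xi_init M N)) < 0 \<longleftrightarrow>
        ?P (fold ring_update (rev w) empty_init)" for w
      by (rule xi_left_iff)
    show "{\<omega> \<in> space \<mu>1. second_class_pos (\<xi> t \<omega>) < 0} \<in> sets \<mu>1"
      by (intro second_class_pos_measurable site)
  qed (rule event | erule init)+
  let ?F = "\<lambda>\<eta>. (num_ge 1 1 \<eta>, num_ge 2 1 \<eta>, num_ge 3 1 \<eta>)"
  let ?G = "\<lambda>\<eta>. (num_ge 1 1 \<eta>, min (int M) (int M + int N - num_ge 1 1 \<eta> + num_ge 1 (M + N + 1) \<eta>),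
     min (int N + 1) (int M + int N + 1 - num_ge 1 (M + N + 1) \<eta> + num_ge 1 (2 * M + 2 * N + 2) \<eta>
        + max 0 (int N - num_ge 1 1 \<eta> + num_ge 1 (M + N + 1) \<eta>)))"
  have NN: "(\<lambda>\<omega>. (NN 1 \<omega>, NN 2 \<omega>, NN 3 \<omega>)) \<in> measurable \<mu>2 (count_space UNIV)"
    using measurable_countable_combine[OF NN_meas NN_meas NN_meas, of "\<lambda>a b c. (a, b, c)" 1 2 3] .
  have X: "(\<lambda>\<omega>. (X1 \<omega>, X2 \<omega>, X3 \<omega>)) \<in> measurable \<mu>3 (count_space UNIV)"
    unfolding X1_def X2_def X3_def
    using S_combine[of "\<lambda>a b c. (a, min (int M) (int M + int N - a + b),
        min (int N + 1) (int M + int N + 1 - b + c + max 0 (int N - a + b)))"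
        1 "M + N + 1" "2 * M + 2 * N + 2"] .
  show "distr \<mu>2 (count_space UNIV) (\<lambda>\<omega>. (NN 1 \<omega>, NN 2 \<omega>, NN 3 \<omega>)) =
      distr \<mu>3 (count_space UNIV) (\<lambda>\<omega>. (X1 \<omega>, X2 \<omega>, X3 \<omega>))"
  \<comment> \<open>Equality in law is tested on an arbitrary set \<open>A\<close> of triples;
    membership in \<open>A\<close> is an event to which the reversal principle applies.\<close>
  proof (rule measure_eqI)
    fix A :: "(int \<times> int \<times> int) set"
    have preF: "{\<omega> \<in> space \<mu>2. ?F (\<xi>' t \<omega>) \<in> A} =
        (\<lambda>\<omega>. (NN 1 \<omega>, NN 2 \<omega>, NN 3 \<omega>)) -` A \<inter> space \<mu>2"
      unfolding NN_def by blast
    have preG: "{\<omega> \<in> space \<mu>3. ?G (\<zeta> t \<omega>) \<in> A} =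
        (\<lambda>\<omega>. (X1 \<omega>, X2 \<omega>, X3 \<omega>)) -` A \<inter> space \<mu>3"
      unfolding X1_def X2_def X3_def S_def by blast
    have "{\<omega> \<in> space \<mu>2. ?F (\<xi>' t \<omega>) \<in> A} \<in> sets \<mu>2"
      unfolding preF by (rule measurable_sets[OF NN]) simp
    moreover have "{\<omega> \<in> space \<mu>3. ?G (\<zeta> t \<omega>) \<in> A} \<in> sets \<mu>3"
      unfolding preG by (rule measurable_sets[OF X]) simp
    moreover have "?F (fold ring_update w (xi_tilde_init M N)) \<in> A \<longleftrightarrow>
        ?G (fold ring_update (rev w) empty_init) \<in> A" for w
      by (simp only: xi_tilde_counts)
    ultimately have "measure \<mu>2 {\<omega> \<in> space \<mu>2. ?F (\<xi>' t \<omega>) \<in> A} = measure \<mu>3 {\<omega> \<in> space \<mu>3. ?G (\<zeta> t \<omega>) \<in> A}"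
      by (intro tasep_word_reversal[OF assms(6,7,3,4), where K = ?K
            and P = "\<lambda>\<eta>. ?F \<eta> \<in> A" and P' = "\<lambda>\<eta>. ?G \<eta> \<in> A"] init)
    then show "emeasure (distr \<mu>2 (count_space UNIV) (\<lambda>\<omega>. (NN 1 \<omega>, NN 2 \<omega>, NN 3 \<omega>))) A =
        emeasure (distr \<mu>3 (count_space UNIV) (\<lambda>\<omega>. (X1 \<omega>, X2 \<omega>, X3 \<omega>))) A"
      unfolding preF preG
      by (simp only: emeasure_distr[OF NN sets_UNIV] emeasure_distr[OF X sets_UNIV]
          \<mu>2.emeasure_eq_measure \<mu>3.emeasure_eq_measure)
  qed simp
qed

end
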